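(* Let $-1/2<\nu<1$ and let $F=\mu+\sqrt\mu f$. Then the ellipsoidal Gaussian $\mathcal{M}_\nu(F)$ can be expanded around $\mu$ as follows: $$\mathcal{M}_\nu(F)=\mu+(P_\nu f)\sqrt\mu+\sum_{1\le i,j\le3}\Big(\int_0^1\big\{D^2_{(\rho_\theta,\rho_\theta U_\theta,G_\theta)}\mathcal{M}_\nu(\theta)\big\}_{ij}(1-\theta)^2\,d\theta\Big)\langle f,e_i\rangle_{L^2_v}\langle f,e_j\rangle_{L^2_v}.$$ Here $P_\nu$ is a $\nu$-perturbation of the usual macroscopic projection $P_0$, $P_\nu f=P_0f+\nu(P_1f+P_2f)$, where $$P_0f=\Big(\int f\sqrt\mu\,dv\Big)\sqrt\mu+\Big(\int fv\sqrt\mu\,dv\Big)\cdot v\sqrt\mu+\Big(\int f\tfrac{|v|^2-3}{\sqrt6}\sqrt\mu\,dv\Big)\tfrac{|v|^2-3}{\sqrt6}\sqrt\mu,$$ $$P_1f=\sum_{i=1}^3\Big(\int f\,\tfrac{3v_i^2-|v|^2}{3\sqrt2}\sqrt\mu\,dv\Big)\tfrac{3v_i^2-|v|^2}{3\sqrt2}\sqrt\mu,\qquad P_2f=\sum_{(i,j)\in\{(1,2),(2,3),(3,1)\}}\Big(\int fv_iv_j\sqrt\mu\,dv\Big)v_iv_j\sqrt\mu,$$ and $$\mathcal{M}_\nu(\theta)=\frac{\rho_\theta}{\sqrt{\det(2\pi\mathcal{T}_\theta)}}\exp\Big(-\tfrac12(v-U_\theta)^\top\mathcal{T}_\theta^{-1}(v-U_\theta)\Big),$$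 with transitional macroscopic fields $\rho_\theta=\theta\rho+(1-\theta)$, $\rho_\theta U_\theta=\theta\rho U$, $G_\theta=\theta G$ and $\mathcal{T}_\theta=(1-\nu)T_\theta\,Id+\nu\Theta_\theta$.
   Context: $F$ is a velocity distribution function of $v\in\mathbb{R}^3$ and $\mu(v)=(2\pi)^{-3/2}e^{-|v|^2/2}$. Macroscopic fields of $F$: $\rho=\int F\,dv$, $\rho U=\int Fv\,dv$, $3\rho T=\int F|v-U|^2dv$, $\rho\Theta=\int F(v-U)\otimes(v-U)dv$, $\mathcal{T}_\nu=(1-\nu)T\,Id+\nu\Theta$, and $$\mathcal{M}_\nu(F)=\frac{\rho}{\sqrt{\det(2\pi\mathcal{T}_\nu)}}\exp\big(-\tfrac12(v-U)^\top\mathcal{T}_\nu^{-1}(v-U)\big).$$ The symmetric matrix $$G=G_\nu=\frac{1-\nu}{3}\Big\{\frac{3\rho T+\rho|U|^2}{2}\Big\}Id+\nu\,\frac{\rho\Theta+\rho U\otimes U}{2}-\frac\rho2Id$$ is viewed as the element $(G_{11},G_{22},G_{33},G_{12},G_{23},G_{31})$ of $\mathbb{R}^6$. In terms of $\mathcal{T}_\nu$ this reads $2G=\rho\mathcal{T}_\nu+\frac{1-\nu}{3}\rho|U|^2Id+\nu\rho\,U\otimes U-\rho\,Id$, so that for fixed $v$ the Gaussian with parameters $(\rho,U,\mathcal{T}_\nu)$ can be regarded as a function of $(\rho,\rho U,G)$. The fields $T_\theta,\Theta_\theta$ (hence $\mathcal{T}_\theta$) are related to $(\rho_\theta,U_\theta,G_\theta)$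 by the same formula as $T,\Theta$ are related to $(\rho,U,G)$. $D^2_{(\rho_\theta,\rho_\theta U_\theta,G_\theta)}\mathcal{M}_\nu(\theta)$ is the matrix of second derivatives with respect to $(\rho,\rho U,G)$, evaluated at $(\rho_\theta,\rho_\theta U_\theta,G_\theta)$. $\langle f,g\rangle_{L^2_v}=\int_{\mathbb{R}^3}fg\,dv$. The quantities $\langle f,e_i\rangle_{L^2_v}$, $i=1,2,3$, stand for the three entries of the triple $(\rho-1,\rho U,G)$ (each of which is a linear moment of $f$ in $v$), and $\{\cdot\}_{ij}$ is the corresponding block of the Hessian; thus the double sum is the quadratic form $(\rho-1,\rho U,G)^\top\{\cdot\}(\rho-1,\rho U,G)$.
   Formalization: The remainder weight (1-θ)^2 is replaced by (1-θ), the correct weight in Taylor's formula; the printed weight fails e.g. for F(v)=μ(v-a e_1) with small a≠0. F is taken nonnegative a.e. with finite mass and energy and ρ>0. *)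

theory Defs
  imports "HOL-Analysis.Analysis"
begin

definition maxwellian :: "real^3 \<Rightarrow> real" where
  "maxwellian v = (2 * pi) powr (- 3 / 2) * exp (- (norm v)\<^sup>2 / 2)"

definition outer :: "real^3 \<Rightarrow> real^3 \<Rightarrow> real^3^3" where
  "outer u w = (\<chi> i j. u $ i * w $ j)"

definition mass_density :: "(real^3 \<Rightarrow> real) \<Rightarrow> real" where
  "mass_density F = (LINT v|lebesgue. F v)"

definition bulk_velocity :: "(real^3 \<Rightarrow> real) \<Rightarrow> real^3" where
  "bulk_velocity F = (1 / mass_density F) *\<^sub>R (LINT v|lebesgue. F v *\<^sub>R v)"

definition temperature :: "(real^3 \<Rightarrow> real) \<Rightarrow> real" where
  "temperature F =
     (1 / (3 * mass_density F)) * (LINT v|lebesgue. F v * (norm (v - bulk_velocity F))\<^sup>2)"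

definition stress_tensor :: "(real^3 \<Rightarrow> real) \<Rightarrow> real^3^3" where
  "stress_tensor F =
     (1 / mass_density F) *\<^sub>R
       (\<chi> i j. LINT v|lebesgue. F v * outer (v - bulk_velocity F) (v - bulk_velocity F) $ i $ j)"

definition temp_tensor :: "real \<Rightarrow> real \<Rightarrow> real^3^3 \<Rightarrow> real^3^3" where
  "temp_tensor \<nu> T \<Theta> = ((1 - \<nu>) * T) *\<^sub>R mat 1 + \<nu> *\<^sub>R \<Theta>"

definition gaussian :: "real \<Rightarrow> real^3 \<Rightarrow> real^3^3 \<Rightarrow> real^3 \<Rightarrow> real" where
  "gaussian \<rho> U S v =
     \<rho> / sqrt (det ((2 * pi) *\<^sub>R S)) *
       exp (- (1 / 2) * ((v - U) \<bullet> (matrix_inv S *v (v - U))))"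

definition ellipsoidal_gaussian :: "real \<Rightarrow> (real^3 \<Rightarrow> real) \<Rightarrow> real^3 \<Rightarrow> real" where
  "ellipsoidal_gaussian \<nu> F v =
     gaussian (mass_density F) (bulk_velocity F)
       (temp_tensor \<nu> (temperature F) (stress_tensor F)) v"

definition G_matrix :: "real \<Rightarrow> real \<Rightarrow> real^3 \<Rightarrow> real \<Rightarrow> real^3^3 \<Rightarrow> real^3^3" where
  "G_matrix \<nu> \<rho> U T \<Theta> =
     ((1 - \<nu>) / 3 * ((3 * \<rho> * T + \<rho> * (norm U)\<^sup>2) / 2)) *\<^sub>R mat 1
     + \<nu> *\<^sub>R ((1 / 2) *\<^sub>R (\<rho> *\<^sub>R \<Theta> + \<rho> *\<^sub>R outer U U))
     - (\<rho> / 2) *\<^sub>R mat 1"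

text \<open>A symmetric matrix is identified with its entries (11, 22, 33, 12, 23, 31).\<close>

definition sym_coords :: "real^3^3 \<Rightarrow> real^6" where
  "sym_coords A = vector [A $ 1 $ 1, A $ 2 $ 2, A $ 3 $ 3, A $ 1 $ 2, A $ 2 $ 3, A $ 3 $ 1]"

definition sym_matrix :: "real^6 \<Rightarrow> real^3^3" where
  "sym_matrix g = vector [vector [g $ 1, g $ 4, g $ 6],
                          vector [g $ 4, g $ 2, g $ 5],
                          vector [g $ 6, g $ 5, g $ 3]]"

lemma sym_matrix_sym_coords:
  assumes "transpose A = A"
  shows "sym_matrix (sym_coords A) = A"
proof -
  have "A $ i $ j = A $ j $ i" for i j
    using arg_cong[OF assms, of "\<lambda>B. B $ j $ i"] by (simp add: transpose_def)
  then show ?thesis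
    by (simp add: vec_eq_iff forall_3 sym_matrix_def sym_coords_def vector_def)
qed

text \<open>The temperature tensor as a function of \<open>(\<rho>, U, G)\<close>, obtained by solving
  \<open>2 G = \<rho> \<T> + (1 - \<nu>)/3 \<rho> |U|\<^sup>2 Id + \<nu> \<rho> U \<otimes> U - \<rho> Id\<close> for \<open>\<T>\<close>.
  The lemma below shows that it is the tensor \<open>(1 - \<nu>) T Id + \<nu> \<Theta>\<close> for any
  \<open>T\<close>, \<open>\<Theta>\<close> related to \<open>(\<rho>, U, G)\<close> by the defining formula of \<open>G\<close>; this form
  also makes sense for \<open>\<nu> = 0\<close>, where \<open>G\<close> does not determine \<open>\<Theta>\<close>.\<close>

definition temp_tensor_of_G :: "real \<Rightarrow> real \<Rightarrow> real^3 \<Rightarrow> real^3^3 \<Rightarrow> real^3^3" where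
  "temp_tensor_of_G \<nu> \<rho> U G =
     (1 / \<rho>) *\<^sub>R (2 *\<^sub>R G + \<rho> *\<^sub>R mat 1
       - ((1 - \<nu>) / 3 * \<rho> * (norm U)\<^sup>2) *\<^sub>R mat 1 - (\<nu> * \<rho>) *\<^sub>R outer U U)"

lemma temp_tensor_of_G_matrix:
  assumes "\<rho> \<noteq> 0"
  shows "temp_tensor_of_G \<nu> \<rho> U (G_matrix \<nu> \<rho> U T \<Theta>) = temp_tensor \<nu> T \<Theta>"
  using assms
  by (simp add: vec_eq_iff temp_tensor_of_G_def G_matrix_def temp_tensor_def mat_def field_simps)

text \<open>The Gaussian at a fixed velocity as a function of \<open>(\<rho>, \<rho>U, G)\<close>.\<close>

definition gaussian_of_state :: "real \<Rightarrow> real^3 \<Rightarrow> real \<times> (real^3) \<times> (real^6) \<Rightarrow> real" where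
  "gaussian_of_state \<nu> v = (\<lambda>(\<rho>, m, g).
     let U = (1 / \<rho>) *\<^sub>R m
     in gaussian \<rho> U (temp_tensor_of_G \<nu> \<rho> U (sym_matrix g)) v)"

definition G_coords :: "real \<Rightarrow> (real^3 \<Rightarrow> real) \<Rightarrow> real^6" where
  "G_coords \<nu> F =
     sym_coords (G_matrix \<nu> (mass_density F) (bulk_velocity F) (temperature F) (stress_tensor F))"

definition transitional_state ::
    "real \<Rightarrow> (real^3 \<Rightarrow> real) \<Rightarrow> real \<Rightarrow> real \<times> (real^3) \<times> (real^6)" where
  "transitional_state \<nu> F \<theta> =
     (\<theta> * mass_density F + (1 - \<theta>),
      \<theta> *\<^sub>R (mass_density F *\<^sub>R bulk_velocity F),
      \<theta> *\<^sub>R G_coords \<nu> F)"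

definition state_deviation ::
    "real \<Rightarrow> (real^3 \<Rightarrow> real) \<Rightarrow> real \<times> (real^3) \<times> (real^6)" where
  "state_deviation \<nu> F =
     (mass_density F - 1, mass_density F *\<^sub>R bulk_velocity F, G_coords \<nu> F)"

text \<open>Partial derivatives are taken along the orthonormal basis \<open>Basis\<close>; the entry
  \<open>hessian_entry g x a b\<close> is \<open>\<partial>\<^sub>a \<partial>\<^sub>b g (x)\<close>.\<close>

definition partial_deriv ::
    "('a::euclidean_space \<Rightarrow> real) \<Rightarrow> 'a \<Rightarrow> 'a \<Rightarrow> real" where
  "partial_deriv g b x = frechet_derivative g (at x) b"

definition hessian_entry ::
    "('a::euclidean_space \<Rightarrow> real) \<Rightarrow> 'a \<Rightarrow> 'a \<Rightarrow> 'a \<Rightarrow> real" where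
  "hessian_entry g x a b = partial_deriv (partial_deriv g b) a x"

definition twice_differentiable_at :: "('a::euclidean_space \<Rightarrow> real) \<Rightarrow> 'a \<Rightarrow> bool" where
  "twice_differentiable_at g x \<longleftrightarrow>
     (\<forall>\<^sub>F y in nhds x. g differentiable (at y)) \<and>
     (\<forall>b\<in>Basis. partial_deriv g b differentiable (at x))"

definition P0 :: "(real^3 \<Rightarrow> real) \<Rightarrow> real^3 \<Rightarrow> real" where
  "P0 f v =
     (LINT w|lebesgue. f w * sqrt (maxwellian w)) * sqrt (maxwellian v)
     + ((LINT w|lebesgue. (f w * sqrt (maxwellian w)) *\<^sub>R w) \<bullet> v) * sqrt (maxwellian v)
     + (LINT w|lebesgue. f w * (((norm w)\<^sup>2 - 3) / sqrt 6) * sqrt (maxwellian w))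
         * (((norm v)\<^sup>2 - 3) / sqrt 6) * sqrt (maxwellian v)"

definition P1 :: "(real^3 \<Rightarrow> real) \<Rightarrow> real^3 \<Rightarrow> real" where
  "P1 f v =
     (\<Sum>i\<in>UNIV.
        (LINT w|lebesgue.
           f w * ((3 * (w $ i)\<^sup>2 - (norm w)\<^sup>2) / (3 * sqrt 2)) * sqrt (maxwellian w))
        * ((3 * (v $ i)\<^sup>2 - (norm v)\<^sup>2) / (3 * sqrt 2)) * sqrt (maxwellian v))"

definition P2 :: "(real^3 \<Rightarrow> real) \<Rightarrow> real^3 \<Rightarrow> real" where
  "P2 f v =
     (\<Sum>(i, j)\<in>{(1, 2), (2, 3), (3, 1)}.
        (LINT w|lebesgue. f w * (w $ i) * (w $ j) * sqrt (maxwellian w))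
        * (v $ i) * (v $ j) * sqrt (maxwellian v))"

definition P_nu :: "real \<Rightarrow> (real^3 \<Rightarrow> real) \<Rightarrow> real^3 \<Rightarrow> real" where
  "P_nu \<nu> f v = P0 f v + \<nu> * (P1 f v + P2 f v)"

end

theory Submission
  imports Defs "HOL-Probability.Distributions"
begin

text \<open>The map \<open>g = gaussian_of_state \<nu> v\<close> is smooth where \<open>\<rho>\<close> and \<open>det \<T>\<close> are positive, because
  Cramer's rule writes \<open>\<T>\<^sup>-\<^sup>1\<close> rationally in the entries of \<open>\<T>\<close>. The transitional states form the
  segment from the state \<open>(1, 0, 0)\<close> of \<open>\<mu>\<close> to the state of \<open>F\<close>. Since \<open>(\<rho>, \<rho> U, G)\<close> consists of moments
  linear in \<open>F\<close>, each point of the segment is the state of the nonnegative mixture \<open>\<theta> F + (1 - \<theta>) \<mu>\<close>, whose tensor \<open>\<T>\<close> is positive definite for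
  \<open>- 1/2 < \<nu> < 1\<close>. Taylor's formula along the segment then applies. Its first-order term is
  \<open>\<mu> (\<rho> - 1 + \<rho> U \<bullet> v + v \<bullet> G v - trace G)\<close>, which is \<open>P\<^sub>\<nu> f\<close> times \<open>\<surd>\<mu>\<close> once the moments of \<open>F - \<mu> = \<surd>\<mu> f\<close>
  are inserted.\<close>

subsection \<open>Functions of class C^k\<close>

text \<open>The recursion runs over partial derivatives along \<open>Basis\<close>, as in
  \<open>hessian_entry\<close>, so order 2 unfolds directly into differentiable first partials and
  continuous Hessian entries. The sets used are open.\<close>

primrec Ck_on :: "nat \<Rightarrow> 'a::euclidean_space set \<Rightarrow> ('a \<Rightarrow> real) \<Rightarrow> bool" where
  "Ck_on 0 S f \<longleftrightarrow> continuous_on S f"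
| "Ck_on (Suc k) S f \<longleftrightarrow>
     (\<forall>x\<in>S. f differentiable (at x)) \<and> (\<forall>b\<in>Basis. Ck_on k S (partial_deriv f b))"

lemma frechet_derivative_cong_open:
  assumes "open S" "x \<in> S" "\<And>y. y \<in> S \<Longrightarrow> f y = g y"
  shows "frechet_derivative f (at x) = frechet_derivative g (at x)"
proof -
  have "(f has_derivative D) (at x) \<longleftrightarrow> (g has_derivative D) (at x)" for D
    using assms has_derivative_transform_within_open[OF _ assms(1,2), of f D UNIV g]
      has_derivative_transform_within_open[OF _ assms(1,2), of g D UNIV f]
    by auto
  then show ?thesis by (simp add: frechet_derivative_def)
qed

lemma Ck_on_cong:
  assumes "open S" "\<And>y. y \<in> S \<Longrightarrow> f y = g y"
  shows "Ck_on k S f \<longleftrightarrow> Ck_on k S g"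
  using assms(2)
proof (induction k arbitrary: f g)
  case 0
  then show ?case by (simp cong: continuous_on_cong)
next
  case (Suc k)
  have d: "f differentiable (at x) \<longleftrightarrow> g differentiable (at x)" if "x \<in> S" for x
    using Suc.prems that
      has_derivative_transform_within_open[OF _ assms(1) that, of f _ UNIV g]
      has_derivative_transform_within_open[OF _ assms(1) that, of g _ UNIV f]
    unfolding differentiable_def by metis
  have "partial_deriv f b x = partial_deriv g b x" if "x \<in> S" for b x
    using frechet_derivative_cong_open[OF \<open>open S\<close> that Suc.prems]
    by (simp add: partial_deriv_def)
  from Suc.IH[OF this] d show ?case by simp
qed

text \<open>The inductive step of the closure rules below: uniqueness of the derivative identifies
  \<open>partial_deriv\<close> on \<open>S\<close> with an explicit formula, and locality on the
  open set lets that formula replace it.\<close>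

lemma Ck_on_SucI:
  assumes "open S" "\<And>x. x \<in> S \<Longrightarrow> (f has_derivative D x) (at x)"
    and "\<And>b. b \<in> Basis \<Longrightarrow> Ck_on k S (\<lambda>x. D x b)"
  shows "Ck_on (Suc k) S f"
proof -
  have "partial_deriv f b x = D x b" if "x \<in> S" for b x
    using frechet_derivative_at[OF assms(2)[OF that]] by (simp add: partial_deriv_def)
  then have "Ck_on k S (partial_deriv f b)" if "b \<in> Basis" for b
    using Ck_on_cong[OF assms(1), of "partial_deriv f b" "\<lambda>x. D x b"] assms(3) that by blast
  then show ?thesis using assms(2) by (auto simp: differentiable_def)
qed

lemma Ck_on_Suc_has_derivative:
  assumes "Ck_on (Suc k) S f" "x \<in> S"
  shows "(f has_derivative (\<lambda>h. partial_deriv f h x)) (at x)"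
  using assms by (simp add: partial_deriv_def flip: frechet_derivative_works)

text \<open>The product and chain rules contain \<open>f\<close> itself beside its partials, so
  their inductive steps need the lower order for \<open>f\<close> too. At the bottom this is
  continuity of differentiable functions.\<close>

lemma Ck_on_SucD: "Ck_on (Suc k) S f \<Longrightarrow> Ck_on k S f"
proof (induction k arbitrary: f)
  case 0
  then show ?case
    by (auto intro!: continuous_at_imp_continuous_on differentiable_imp_continuous_within)
next
  case (Suc k)
  have "Ck_on k S (partial_deriv f b)" if "b \<in> Basis" for b
    by (rule Suc.IH) (use Suc.prems that in simp)
  then show ?case using Suc.prems by simp
qed

lemma Ck_on_mono: "Ck_on n S f \<Longrightarrow> k \<le> n \<Longrightarrow> Ck_on k S f"
proof (induction n)
  case (Suc n)
  then show ?case using Ck_on_SucD[OF Suc.prems(1)] by (cases "k = Suc n") auto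
qed simp

lemma Ck_on_imp_continuous_on: "Ck_on k S f \<Longrightarrow> continuous_on S f"
  using Ck_on_mono[of k S f 0] by simp

lemma Ck_on_subset:
  assumes "Ck_on k S f" "T \<subseteq> S"
  shows "Ck_on k T f"
  using assms(1)
proof (induction k arbitrary: f)
  case 0
  then show ?case using assms(2) by (simp add: continuous_on_subset)
next
  case (Suc k)
  then show ?case using assms(2) by auto
qed

lemma Ck_on_const:
  assumes "open S"
  shows "Ck_on k S (\<lambda>x. c)"
proof (induction k arbitrary: c)
  case (Suc k)
  show ?case by (rule Ck_on_SucI[OF assms, where D = "\<lambda>x h. 0"]) (simp_all add: Suc del: Ck_on.simps)
qed simp

lemma Ck_on_linear:
  assumes "open S" "bounded_linear f"
  shows "Ck_on k S f"
proof (cases k)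
  case 0
  then show ?thesis using assms by (simp add: linear_continuous_on)
next
  case (Suc n)
  then show ?thesis
    by (metis Ck_on_SucI[OF assms(1) bounded_linear_imp_has_derivative[OF assms(2)]] Ck_on_const[OF assms(1)])
qed

lemma Ck_on_add:
  assumes "open S" "Ck_on k S f" "Ck_on k S g"
  shows "Ck_on k S (\<lambda>x. f x + g x)"
  using assms(2,3)
proof (induction k arbitrary: f g)
  case 0
  then show ?case by (simp add: continuous_on_add)
next
  case (Suc k)
  show ?case
  proof (rule Ck_on_SucI[OF assms(1)])
    show "((\<lambda>x. f x + g x) has_derivative (\<lambda>h. partial_deriv f h x + partial_deriv g h x)) (at x)"
      if "x \<in> S" for x
      using that Suc.prems by (intro has_derivative_add Ck_on_Suc_has_derivative)
  qed (use Suc in auto)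
qed

lemma Ck_on_mult:
  assumes "open S" "Ck_on k S f" "Ck_on k S g"
  shows "Ck_on k S (\<lambda>x. f x * g x)"
  using assms(2,3)
proof (induction k arbitrary: f g)
  case 0
  then show ?case by (simp add: continuous_on_mult)
next
  case (Suc k)
  show ?case
  proof (rule Ck_on_SucI[OF assms(1)])
    show "((\<lambda>x. f x * g x) has_derivative
        (\<lambda>h. f x * partial_deriv g h x + partial_deriv f h x * g x)) (at x)"
      if "x \<in> S" for x
      using that Suc.prems by (intro has_derivative_mult Ck_on_Suc_has_derivative)
    show "Ck_on k S (\<lambda>x. f x * partial_deriv g b x + partial_deriv f b x * g x)"
      if "b \<in> Basis" for b
      using Suc.prems that Suc.prems[THEN Ck_on_SucD]
      by (intro Ck_on_add[OF assms(1)] Suc.IH) (simp_all only: Ck_on.simps)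
  qed
qed

lemma Ck_on_minus:
  assumes "open S" "Ck_on k S f"
  shows "Ck_on k S (\<lambda>x. - f x)"
  using Ck_on_mult[OF assms(1) Ck_on_const[OF assms(1), of k "-1"] assms(2)] by simp

lemma Ck_on_diff:
  assumes "open S" "Ck_on k S f" "Ck_on k S g"
  shows "Ck_on k S (\<lambda>x. f x - g x)"
  using Ck_on_add[OF assms(1,2) Ck_on_minus[OF assms(1,3)]] by simp

lemma Ck_on_sum:
  assumes "open S" "\<And>i. i \<in> I \<Longrightarrow> Ck_on k S (f i)"
  shows "Ck_on k S (\<lambda>x. \<Sum>i\<in>I. f i x)"
  using assms(2)
  by (induction I rule: infinite_finite_induct)
    (simp_all add: Ck_on_const Ck_on_add assms(1) del: Ck_on.simps)

text \<open>The derivative is a polynomial in \<open>1 / f\<close> and the partials of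
  \<open>f\<close>, so the induction keeps \<open>f\<close> fixed and feeds \<open>1 / f\<close>
  back at the lower order. \<open>Ck_on_exp\<close> and \<open>Ck_on_sqrt\<close> follow the same
  scheme.\<close>

lemma Ck_on_inverse:
  assumes "open S" "Ck_on k S f" "\<And>x. x \<in> S \<Longrightarrow> f x \<noteq> 0"
  shows "Ck_on k S (\<lambda>x. inverse (f x))"
  using assms(2)
proof (induction k)
  case 0
  then show ?case using assms(3) by (simp add: continuous_on_inverse)
next
  case (Suc k)
  show ?case
  proof (rule Ck_on_SucI[OF assms(1)])
    show "((\<lambda>x. inverse (f x)) has_derivative
        (\<lambda>h. - (inverse (f x) * partial_deriv f h x * inverse (f x)))) (at x)"
      if "x \<in> S" for x
      using that Suc.prems assms(3) by (intro Deriv.has_derivative_inverse Ck_on_Suc_has_derivative)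
    show "Ck_on k S (\<lambda>x. - (inverse (f x) * partial_deriv f b x * inverse (f x)))"
      if "b \<in> Basis" for b
      using Suc that
      by (intro Ck_on_minus Ck_on_mult assms(1) Suc.IH Ck_on_SucD[OF Suc.prems]) auto
  qed
qed

lemma Ck_on_divide:
  assumes "open S" "Ck_on k S f" "Ck_on k S g" "\<And>x. x \<in> S \<Longrightarrow> g x \<noteq> 0"
  shows "Ck_on k S (\<lambda>x. f x / g x)"
  using Ck_on_mult[OF assms(1,2) Ck_on_inverse[OF assms(1,3,4)]] by (simp add: divide_inverse)

lemma Ck_on_exp:
  assumes "open S" "Ck_on k S f"
  shows "Ck_on k S (\<lambda>x. exp (f x))"
  using assms(2)
proof (induction k)
  case 0
  then show ?case by (simp add: continuous_on_exp)
next
  case (Suc k)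
  show ?case
  proof (rule Ck_on_SucI[OF assms(1)])
    show "((\<lambda>x. exp (f x)) has_derivative (\<lambda>h. partial_deriv f h x * exp (f x))) (at x)"
      if "x \<in> S" for x
      using has_derivative_exp[OF Ck_on_Suc_has_derivative[OF Suc.prems that]] by simp
    show "Ck_on k S (\<lambda>x. partial_deriv f b x * exp (f x))" if "b \<in> Basis" for b
      using Suc that by (intro Ck_on_mult assms(1) Suc.IH Ck_on_SucD[OF Suc.prems]) auto
  qed
qed

lemma Ck_on_sqrt:
  assumes "open S" "Ck_on k S f" "\<And>x. x \<in> S \<Longrightarrow> 0 < f x"
  shows "Ck_on k S (\<lambda>x. sqrt (f x))"
  using assms(2)
proof (induction k)
  case 0
  then show ?case by (simp add: continuous_on_real_sqrt)
next
  case (Suc k)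
  show ?case
  proof (rule Ck_on_SucI[OF assms(1)])
    show "((\<lambda>x. sqrt (f x)) has_derivative
        (\<lambda>h. partial_deriv f h x * (inverse (sqrt (f x)) * (1/2)))) (at x)"
      if "x \<in> S" for x
      using has_derivative_real_sqrt[OF assms(3)[OF that] Ck_on_Suc_has_derivative[OF Suc.prems that]]
      by (simp add: field_simps)
    have nz: "sqrt (f x) \<noteq> 0" if "x \<in> S" for x using assms(3)[OF that] by simp
    show "Ck_on k S (\<lambda>x. partial_deriv f b x * (inverse (sqrt (f x)) * (1/2)))"
      if "b \<in> Basis" for b
      using Suc that nz
      by (intro Ck_on_mult Ck_on_inverse Ck_on_const assms(1) Suc.IH Ck_on_SucD[OF Suc.prems]) auto
  qed
qed

lemma Ck_on_det_3:
  fixes A :: "'a::euclidean_space \<Rightarrow> real^3^3"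
  assumes "open S" "\<And>i j. Ck_on k S (\<lambda>x. A x $ i $ j)"
  shows "Ck_on k S (\<lambda>x. det (A x))"
  unfolding det_3 by (intro Ck_on_add Ck_on_diff Ck_on_mult assms)

section \<open>Second-order Taylor formula along a segment\<close>

lemma partial_deriv_expand:
  assumes "f differentiable (at x)"
  shows "partial_deriv f h x = (\<Sum>b\<in>Basis. (h \<bullet> b) * partial_deriv f b x)"
proof -
  interpret linear "frechet_derivative f (at x)"
    by (rule linear_frechet_derivative[OF assms])
  have "partial_deriv f h x = frechet_derivative f (at x) (\<Sum>b\<in>Basis. (h \<bullet> b) *\<^sub>R b)"
    by (simp add: partial_deriv_def euclidean_representation)
  also have "\<dots> = (\<Sum>b\<in>Basis. (h \<bullet> b) * partial_deriv f b x)"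
    by (simp add: sum scaleR partial_deriv_def)
  finally show ?thesis .
qed

lemma C2_on_imp_twice_differentiable_at:
  assumes "open S" "Ck_on 2 S g" "x \<in> S"
  shows "twice_differentiable_at g x"
proof -
  have "\<forall>\<^sub>F y in nhds x. y \<in> S" using assms(1,3) by (simp add: eventually_nhds_in_open)
  then have "\<forall>\<^sub>F y in nhds x. g differentiable (at y)"
    by eventually_elim (use assms(2) in \<open>auto simp: numeral_2_eq_2\<close>)
  then show ?thesis
    using assms(2,3) by (auto simp: twice_differentiable_at_def numeral_2_eq_2)
qed

lemma C2_on_hessian_continuous:
  assumes "Ck_on 2 S g" "a \<in> Basis" "b \<in> Basis"
  shows "continuous_on S (\<lambda>x. hessian_entry g x a b)"
  using assms unfolding numeral_2_eq_2 hessian_entry_def by simp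

text \<open>The remainder is found by differentiating \<open>\<phi> \<theta> + (1 - \<theta>) \<phi>' \<theta>\<close> for
  \<open>\<phi> \<theta> = g (x + \<theta> d)\<close>.\<close>

lemma taylor_2_segment:
  assumes "open S" "Ck_on 2 S g"
    and seg: "\<And>\<theta>. \<theta> \<in> {0..1} \<Longrightarrow> x + \<theta> *\<^sub>R d \<in> S"
  shows "a \<in> Basis \<Longrightarrow> b \<in> Basis \<Longrightarrow>
      (\<lambda>\<theta>. hessian_entry g (x + \<theta> *\<^sub>R d) a b * (1 - \<theta>)) integrable_on {0..1}"
    and "g (x + d) = g x + partial_deriv g d x
      + (\<Sum>a\<in>Basis. \<Sum>b\<in>Basis.
          integral {0..1} (\<lambda>\<theta>. hessian_entry g (x + \<theta> *\<^sub>R d) a b * (1 - \<theta>)) * (d \<bullet> a) * (d \<bullet> b))"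
proof -
  let ?p = "\<lambda>\<theta>. x + \<theta> *\<^sub>R d"
  let ?H = "\<lambda>a b \<theta>. hessian_entry g (?p \<theta>) a b * (1 - \<theta>)"
  have int: "?H a b integrable_on {0..1}" if "a \<in> Basis" "b \<in> Basis" for a b
  proof (rule integrable_continuous_real)
    have "continuous_on {0..1} ?p" by (intro continuous_intros)
    then have "continuous_on {0..1} (\<lambda>\<theta>. hessian_entry g (?p \<theta>) a b)"
      by (rule continuous_on_compose2[OF C2_on_hessian_continuous[OF assms(2) that]])
        (use seg in auto)
    then show "continuous_on {0..1} (?H a b)"
      by (rule continuous_on_mult) (intro continuous_intros)
  qed
  show "a \<in> Basis \<Longrightarrow> b \<in> Basis \<Longrightarrow> ?H a b integrable_on {0..1}" by (rule int)
  have C1: "Ck_on 1 S (partial_deriv g b)" if "b \<in> Basis" for b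
    using assms(2) that by (simp add: numeral_2_eq_2)
  have Dp: "(?p has_derivative (\<lambda>t. t *\<^sub>R d)) (at \<theta> within T)" for \<theta> T
    by (auto intro!: derivative_eq_intros)
  have D1: "((\<lambda>\<theta>. g (?p \<theta>)) has_real_derivative (\<Sum>b\<in>Basis. (d \<bullet> b) * partial_deriv g b (?p \<theta>)))
      (at \<theta> within {0..1})" if "\<theta> \<in> {0..1}" for \<theta>
  proof -
    have gd: "(g has_derivative frechet_derivative g (at (?p \<theta>))) (at (?p \<theta>))"
      and dif: "g differentiable (at (?p \<theta>))"
      using assms(2) seg[OF that] by (auto simp: numeral_2_eq_2 simp flip: frechet_derivative_works)
    interpret linear "frechet_derivative g (at (?p \<theta>))"
      by (rule linear_frechet_derivative[OF dif])
    have "((\<lambda>\<theta>. g (?p \<theta>)) has_derivative (\<lambda>t. frechet_derivative g (at (?p \<theta>)) (t *\<^sub>R d)))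
        (at \<theta> within {0..1})"
      by (rule has_derivative_compose[OF Dp gd])
    then show ?thesis
      unfolding has_field_derivative_def scaleR real_scaleR_def mult_commute_abs
      using partial_deriv_expand[OF dif, of d] by (simp add: partial_deriv_def)
  qed
  have D2: "((\<lambda>\<theta>. partial_deriv g b (?p \<theta>)) has_real_derivative
      (\<Sum>a\<in>Basis. (d \<bullet> a) * hessian_entry g (?p \<theta>) a b)) (at \<theta> within {0..1})"
    if "\<theta> \<in> {0..1}" "b \<in> Basis" for \<theta> b
  proof -
    let ?g = "partial_deriv g b"
    have dif: "?g differentiable (at (?p \<theta>))"
      using C1[OF that(2)] seg[OF that(1)] by simp
    then have gd: "(?g has_derivative frechet_derivative ?g (at (?p \<theta>))) (at (?p \<theta>))"
      by (rule frechet_derivative_works[THEN iffD1])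
    interpret linear "frechet_derivative ?g (at (?p \<theta>))"
      by (rule linear_frechet_derivative[OF dif])
    have "((\<lambda>\<theta>. ?g (?p \<theta>)) has_derivative (\<lambda>t. frechet_derivative ?g (at (?p \<theta>)) (t *\<^sub>R d)))
        (at \<theta> within {0..1})"
      by (rule has_derivative_compose[OF Dp gd])
    then show ?thesis
      unfolding has_field_derivative_def scaleR real_scaleR_def mult_commute_abs
      using partial_deriv_expand[OF dif, of d] by (simp add: partial_deriv_def hessian_entry_def)
  qed
  define \<psi> where "\<psi> \<theta> = g (?p \<theta>) + (1 - \<theta>) * (\<Sum>b\<in>Basis. (d \<bullet> b) * partial_deriv g b (?p \<theta>))" for \<theta>
  have "(\<psi> has_vector_derivative (\<Sum>a\<in>Basis. \<Sum>b\<in>Basis. ?H a b \<theta> * (d \<bullet> a) * (d \<bullet> b)))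
      (at \<theta> within {0..1})" if "\<theta> \<in> {0..1}" for \<theta>
  proof -
    \<comment> \<open>The first-order sum cancels against the derivative of the factor
      \<open>1 - \<theta>\<close>; only the second-order term survives.\<close>
    have "(\<psi> has_real_derivative
        (1 - \<theta>) * (\<Sum>b\<in>Basis. (d \<bullet> b) * (\<Sum>a\<in>Basis. (d \<bullet> a) * hessian_entry g (?p \<theta>) a b)))
        (at \<theta> within {0..1})"
      unfolding \<psi>_def using that
      by (auto intro!: derivative_eq_intros D1 D2 simp: mult.commute)
    \<comment> \<open>Only the sums change order; each entry keeps its arguments \<open>a\<close>,
      \<open>b\<close>, so symmetry of the Hessian is not invoked.\<close>
    moreover have "(1 - \<theta>) * (\<Sum>b\<in>Basis. (d \<bullet> b) * (\<Sum>a\<in>Basis. (d \<bullet> a) * hessian_entry g (?p \<theta>) a b))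
        = (\<Sum>a\<in>Basis. \<Sum>b\<in>Basis. ?H a b \<theta> * (d \<bullet> a) * (d \<bullet> b))"
      by (subst sum.swap) (simp add: sum_distrib_left mult_ac)
    ultimately show ?thesis by (simp add: has_real_derivative_iff_has_vector_derivative)
  qed
  then have "((\<lambda>\<theta>. \<Sum>a\<in>Basis. \<Sum>b\<in>Basis. ?H a b \<theta> * (d \<bullet> a) * (d \<bullet> b)) has_integral (\<psi> 1 - \<psi> 0)) {0..1}"
    by (intro fundamental_theorem_of_calculus) auto
  moreover have "((\<lambda>\<theta>. \<Sum>a\<in>Basis. \<Sum>b\<in>Basis. ?H a b \<theta> * (d \<bullet> a) * (d \<bullet> b)) has_integral
      (\<Sum>a\<in>Basis. \<Sum>b\<in>Basis. integral {0..1} (?H a b) * (d \<bullet> a) * (d \<bullet> b))) {0..1}"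
    using int by (intro has_integral_sum has_integral_mult_left integrable_integral) auto
  ultimately have "\<psi> 1 - \<psi> 0 = (\<Sum>a\<in>Basis. \<Sum>b\<in>Basis. integral {0..1} (?H a b) * (d \<bullet> a) * (d \<bullet> b))"
    by (rule has_integral_unique)
  moreover have "g differentiable (at x)"
    using assms(2) seg[of 0] by (auto simp: numeral_2_eq_2)
  ultimately show "g (x + d) = g x + partial_deriv g d x
      + (\<Sum>a\<in>Basis. \<Sum>b\<in>Basis. integral {0..1} (?H a b) * (d \<bullet> a) * (d \<bullet> b))"
    using partial_deriv_expand[of g x d] by (simp add: \<psi>_def)
qed

subsection \<open>The Gaussian as a function of the state\<close>

definition state_tensor :: "real \<Rightarrow> real \<times> (real^3) \<times> (real^6) \<Rightarrow> real^3^3" where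
  "state_tensor \<nu> x = temp_tensor_of_G \<nu> (fst x) ((1 / fst x) *\<^sub>R fst (snd x)) (sym_matrix (snd (snd x)))"

text \<open>A positive determinant is an open condition and suffices for the square root and for
  Cramer's rule. Positive definiteness serves only to show that given states lie here.\<close>

definition state_domain :: "real \<Rightarrow> (real \<times> (real^3) \<times> (real^6)) set" where
  "state_domain \<nu> = {x. 0 < fst x \<and> 0 < det (state_tensor \<nu> x)}"

text \<open>Replaces the inverse, defined by choice, with quotients of determinants, whose smooth
  dependence on the entries is visible.\<close>

lemma matrix_inv_mult_cramer:
  fixes A :: "real^'n^'n"
  assumes "det A \<noteq> 0"
  shows "matrix_inv A *v w = (\<chi> k. det (\<chi> i j. if j = k then w $ i else A $ i $ j) / det A)"
proof -
  have "\<exists>B. A ** B = mat 1 \<and> B ** A = mat 1"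
    using assms invertible_det_nz[of A] unfolding invertible_def by blast
  then have inv: "A ** matrix_inv A = mat 1"
    unfolding matrix_inv_def by (rule someI2_ex) simp
  have "A *v (matrix_inv A *v w) = w"
    using inv by (simp add: matrix_vector_mul_assoc)
  then show ?thesis using cramer[OF assms] by blast
qed

lemma gaussian_cramer:
  assumes "det S \<noteq> 0"
  shows "gaussian \<rho> U S v = \<rho> / sqrt ((2 * pi)^3 * det S) *
    exp (- (1/2) * ((\<Sum>k\<in>UNIV. (v $ k - U $ k) *
      det (\<chi> i j. if j = k then v $ i - U $ i else S $ i $ j)) / det S))"
proof -
  have "det (c *\<^sub>R S) = c^3 * det S" for c :: real
    by (simp add: det_3 power3_eq_cube algebra_simps)
  moreover have "(v - U) \<bullet> (matrix_inv S *v (v - U)) = (\<Sum>k\<in>UNIV. (v $ k - U $ k) *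
      det (\<chi> i j. if j = k then v $ i - U $ i else S $ i $ j)) / det S"
    unfolding matrix_inv_mult_cramer[OF assms]
    by (simp add: inner_vec_def sum_divide_distrib cong: if_cong)
  ultimately show ?thesis by (simp add: gaussian_def)
qed

text \<open>Unfolds the norm and the outer product into products of \<open>m / \<rho>\<close>, the
  shape to which the \<open>Ck_on\<close> rules apply.\<close>

lemma state_tensor_nth:
  "state_tensor \<nu> x $ i $ j = (1 / fst x) * (2 * sym_matrix (snd (snd x)) $ i $ j
     + fst x * (mat 1 $ i $ j)
     - ((1 - \<nu>) / 3 * fst x * (\<Sum>k\<in>UNIV. (fst (snd x) $ k / fst x) * (fst (snd x) $ k / fst x))) * (mat 1 $ i $ j)
     - (\<nu> * fst x) * ((fst (snd x) $ i / fst x) * (fst (snd x) $ j / fst x)))"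
  unfolding state_tensor_def temp_tensor_of_G_def outer_def power2_norm_eq_inner inner_vec_def
  by simp

lemma sym_matrix_nth_bounded_linear: "bounded_linear (\<lambda>g. sym_matrix g $ i $ j)"
  using exhaust_3[of i] exhaust_3[of j]
  by (auto simp: sym_matrix_def bounded_linear_vec_nth)

lemma open_fst_pos: "open {x :: real \<times> 'a::topological_space. 0 < fst x}"
  by (intro open_Collect_less continuous_intros)

lemma Ck_on_state_tensor: "Ck_on k {x. 0 < fst x} (\<lambda>x. state_tensor \<nu> x $ i $ j)"
  unfolding state_tensor_nth
  by (intro Ck_on_add Ck_on_diff Ck_on_mult Ck_on_divide Ck_on_sum Ck_on_const Ck_on_linear open_fst_pos
      bounded_linear_fst bounded_linear_compose[OF bounded_linear_vec_nth] bounded_linear_fst_comp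
      bounded_linear_snd
      bounded_linear_compose[OF sym_matrix_nth_bounded_linear] bounded_linear_snd_comp) auto

text \<open>The tensor divides by \<open>\<rho>\<close>, so continuity of its determinant is taken
  on the open half-space \<open>0 < fst x\<close>, and the preimage is formed there.\<close>

lemma open_state_domain: "open (state_domain \<nu>)"
proof -
  have "continuous_on {x. 0 < fst x} (\<lambda>x. det (state_tensor \<nu> x))"
    using Ck_on_det_3[OF open_fst_pos Ck_on_state_tensor] by (rule Ck_on_imp_continuous_on)
  from continuous_open_preimage[OF this open_fst_pos, of "{0<..}"] show ?thesis
    by (simp add: state_domain_def vimage_def Int_def)
qed

lemma gaussian_of_state_eq:
  "gaussian_of_state \<nu> v x = gaussian (fst x) ((1 / fst x) *\<^sub>R fst (snd x)) (state_tensor \<nu> x) v"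
  by (simp add: gaussian_of_state_def state_tensor_def case_prod_beta Let_def)

lemma Ck_on_gaussian_of_state: "Ck_on k (state_domain \<nu>) (gaussian_of_state \<nu> v)"
proof -
  let ?S = "state_domain \<nu>"
  let ?U = "\<lambda>x i. fst (snd x) $ i / fst x"
  have "?S \<subseteq> {x. 0 < fst x}" by (auto simp: state_domain_def)
  then have T: "Ck_on k ?S (\<lambda>x. state_tensor \<nu> x $ i $ j)" for i j
    using Ck_on_state_tensor Ck_on_subset by blast
  have w: "Ck_on k ?S (\<lambda>x. v $ i - ?U x i)" for i
    by (intro Ck_on_diff Ck_on_divide Ck_on_const Ck_on_linear open_state_domain
        bounded_linear_fst bounded_linear_compose[OF bounded_linear_vec_nth] bounded_linear_fst_comp
        bounded_linear_snd) (auto simp: state_domain_def)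
  have D: "Ck_on k ?S (\<lambda>x. det (\<chi> i j. if j = l then v $ i - ?U x i else state_tensor \<nu> x $ i $ j))" for l
  proof (rule Ck_on_det_3[OF open_state_domain])
    show "Ck_on k ?S (\<lambda>x. (\<chi> i j. if j = l then v $ i - ?U x i else state_tensor \<nu> x $ i $ j) $ i $ j)" for i j
      \<comment> \<open>Column \<open>l\<close> is the one replaced by Cramer's rule; the other
        columns are those of the tensor.\<close>
      by (cases "j = l") (simp_all add: T w)
  qed
  have fst: "Ck_on k ?S fst"
    by (intro Ck_on_linear open_state_domain bounded_linear_fst)
  have "Ck_on k ?S (\<lambda>x. fst x / sqrt ((2 * pi)^3 * det (state_tensor \<nu> x)) *
    exp (- (1/2) * ((\<Sum>l\<in>UNIV. (v $ l - ?U x l) *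
      det (\<chi> i j. if j = l then v $ i - ?U x i else state_tensor \<nu> x $ i $ j)) / det (state_tensor \<nu> x))))"
    by (intro Ck_on_divide Ck_on_mult Ck_on_exp Ck_on_sqrt Ck_on_sum fst w D Ck_on_const
        Ck_on_det_3 T open_state_domain)
      (auto simp: state_domain_def)
  \<comment> \<open>The determinantal formula is claimed only on the domain, where the determinant
    is nonzero; \<open>Ck_on_cong\<close> transfers smoothness from there.\<close>
  moreover have "gaussian_of_state \<nu> v x = fst x / sqrt ((2 * pi)^3 * det (state_tensor \<nu> x)) *
    exp (- (1/2) * ((\<Sum>l\<in>UNIV. (v $ l - ?U x l) *
      det (\<chi> i j. if j = l then v $ i - ?U x i else state_tensor \<nu> x $ i $ j)) / det (state_tensor \<nu> x)))"
    if "x \<in> ?S" for x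
    using that by (subst gaussian_of_state_eq, subst gaussian_cramer) (auto simp: state_domain_def cong: if_cong)
  ultimately show ?thesis by (subst Ck_on_cong[OF open_state_domain]) 
qed

section \<open>Value and first derivative at the equilibrium state\<close>

lemma gaussian_mat_1: "gaussian 1 0 (mat 1) v = maxwellian v"
proof -
  have "sqrt (c^3) = c powr (3/2)" if "0 < c" for c :: real
  proof -
    have "c^3 = c powr 3" using that by simp
    then have "sqrt (c^3) = (c powr 3) powr (1/2)" using that by (simp add: powr_half_sqrt)
    then show ?thesis by (simp add: powr_powr)
  qed
  from this[of "2 * pi"] have "sqrt ((2 * pi)^3) = (2 * pi) powr (3/2)" by simp
  moreover have "(\<Sum>k\<in>UNIV. v $ k * det (\<chi> i j. if j = k then v $ i else mat 1 $ i $ j)) = (norm v)\<^sup>2"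
    by (simp add: power2_norm_eq_inner inner_vec_def sum_3 det_3 mat_def)
  ultimately have "gaussian 1 0 (mat 1) v = 1 / (2 * pi) powr (3/2) * exp (- (1/2) * (norm v)\<^sup>2)"
    using gaussian_cramer[of "mat 1" 1 0 v] by (simp cong: if_cong)
  also have "1 / (2 * pi) powr (3/2) = (2 * pi) powr (- 3/2)"
    by (simp add: powr_minus_divide[symmetric])
  finally show ?thesis by (simp add: maxwellian_def)
qed

text \<open>At the identity the determinant \<open>D\<close> has derivative \<open>trace A\<close>.
  The adjugate form \<open>Q\<close> contributes \<open>trace A * (norm v)^2\<close>, which cancels
  in the quotient \<open>Q / D\<close>; the trace therefore survives only through
  \<open>1 / sqrt D\<close>.\<close>

lemma DERIV_gaussian_mat_1:
  fixes \<rho> :: "real \<Rightarrow> real" and U :: "real \<Rightarrow> real^3" and S :: "real \<Rightarrow> real^3^3"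
  assumes 0: "\<rho> 0 = 1" "U 0 = 0" "S 0 = mat 1"
    and d\<rho>: "(\<rho> has_real_derivative r) (at 0)"
    and dU: "\<And>i. ((\<lambda>t. U t $ i) has_real_derivative u $ i) (at 0)"
    and dS: "\<And>i j. ((\<lambda>t. S t $ i $ j) has_real_derivative A $ i $ j) (at 0)"
  shows "((\<lambda>t. gaussian (\<rho> t) (U t) (S t) v) has_real_derivative
    maxwellian v * (r + u \<bullet> v + (v \<bullet> (A *v v) - trace A) / 2)) (at 0)"
proof -
  define D where "D t = det (S t)" for t
  define Q where "Q t = (\<Sum>k\<in>UNIV. (v $ k - U t $ k) *
      det (\<chi> i j. if j = k then v $ i - U t $ i else S t $ i $ j))" for t
  define C where "C = 1 / sqrt ((2 * pi)^3)"
  have D0: "D 0 = 1" by (simp add: D_def 0)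
  have Q0: "Q 0 = (norm v)\<^sup>2"
    by (simp add: Q_def 0 power2_norm_eq_inner inner_vec_def sum_3 det_3 mat_def)
  have dD: "(D has_real_derivative trace A) (at 0)"
    unfolding D_def det_3
    by (rule DERIV_cong, (rule derivative_intros dS)+) (simp add: 0 mat_def trace_def sum_3)
  have dQ: "(Q has_real_derivative trace A * (norm v)\<^sup>2 - v \<bullet> (A *v v) - 2 * (u \<bullet> v)) (at 0)"
    unfolding Q_def det_3 sum_3 vec_lambda_beta
    by (simp, rule DERIV_cong, (rule derivative_intros dS dU)+)
      (simp add: 0 mat_def trace_def sum_3 power2_norm_eq_inner inner_vec_def
        matrix_vector_mult_def algebra_simps)
  have "isCont D 0" using dD by (rule DERIV_isCont)
  then have "(D \<longlongrightarrow> 1) (at 0)" by (simp add: isCont_def D0)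
  then have "\<forall>\<^sub>F t in at 0. 0 < D t" by (rule order_tendstoD) simp
  \<comment> \<open>The neighbourhood must include \<open>0\<close> itself: the identity
    \<open>eq\<close> is later evaluated there and passed to \<open>DERIV_cong_ev\<close>.\<close>
  then have ev: "\<forall>\<^sub>F t in nhds 0. 0 < D t" by (simp add: eventually_nhds_conv_at D0)
  then have eq: "\<forall>\<^sub>F t in nhds 0. gaussian (\<rho> t) (U t) (S t) v = C * \<rho> t / sqrt (D t) * exp (- (1/2) * (Q t / D t))"
    by eventually_elim (subst gaussian_cramer, auto simp: D_def Q_def C_def real_sqrt_mult)
  have "((\<lambda>t. C * \<rho> t / sqrt (D t) * exp (- (1/2) * (Q t / D t))) has_real_derivative
      C * exp (- (norm v)\<^sup>2 / 2) * (r + u \<bullet> v + (v \<bullet> (A *v v) - trace A) / 2)) (at 0)"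
  proof -
    have dI: "((\<lambda>t. inverse (sqrt (D t))) has_real_derivative - (trace A / 2)) (at 0)"
      using dD D0 by (auto intro!: derivative_eq_intros)
    have dE: "((\<lambda>t. exp (- (1/2) * (Q t / D t))) has_real_derivative
        exp (- (norm v)\<^sup>2 / 2) * (u \<bullet> v + v \<bullet> (A *v v) / 2)) (at 0)"
      by (auto intro!: derivative_eq_intros dQ dD simp: D0 Q0 field_simps)
    have "((\<lambda>t. C * \<rho> t * inverse (sqrt (D t)) * exp (- (1/2) * (Q t / D t))) has_real_derivative
      C * exp (- (norm v)\<^sup>2 / 2) * (r + u \<bullet> v + (v \<bullet> (A *v v) - trace A) / 2)) (at 0)"
      by (rule DERIV_cong, (rule dI dE d\<rho> derivative_intros)+)
        (simp add: 0 D0 Q0 algebra_simps diff_divide_distrib add_divide_distrib)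
    then show ?thesis by (simp only: divide_inverse)
  qed
  \<comment> \<open>Evaluating \<open>eq\<close> at \<open>t = 0\<close> identifies the constant,
    without another computation with powers of \<open>2 * pi\<close>.\<close>
  moreover have "maxwellian v = C * exp (- (norm v)\<^sup>2 / 2)"
  proof -
    have "maxwellian v = C * \<rho> 0 / sqrt (D 0) * exp (- (1/2) * (Q 0 / D 0))"
      using eventually_nhds_x_imp_x[OF eq] by (simp add: 0 gaussian_mat_1)
    then show ?thesis by (simp add: 0 D0 Q0)
  qed
  ultimately show ?thesis
    using DERIV_cong_ev[OF refl eq refl] by simp
qed

lemma state_tensor_equilibrium: "state_tensor \<nu> (1, 0, 0) = mat 1"
proof -
  have "sym_matrix 0 $ i $ j = 0" for i j
    by (rule linear_0[OF bounded_linear.linear[OF sym_matrix_nth_bounded_linear]])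
  then show ?thesis by (simp add: vec_eq_iff state_tensor_nth)
qed

text \<open>The directional derivative is computed along the ray from equilibrium. To first order
  the velocity moves by \<open>m\<close> and the tensor by \<open>2 G\<close>: the variation of
  \<open>1 / \<rho>\<close> cancels that of \<open>\<rho> Id\<close>, and the terms quadratic in the
  velocity vanish, taking \<open>\<nu>\<close> with them.\<close>

lemma partial_deriv_gaussian_of_state_equilibrium:
  "partial_deriv (gaussian_of_state \<nu> v) (r, m, g) (1, 0, 0) =
    maxwellian v * (r + m \<bullet> v + v \<bullet> (sym_matrix g *v v) - trace (sym_matrix g))"
proof -
  let ?x = "\<lambda>t::real. (1, 0, 0) + t *\<^sub>R (r, m, g)"
  have lin: "sym_matrix (t *\<^sub>R g) $ i $ j = t * sym_matrix g $ i $ j" for t i j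
    using linear_scale[OF bounded_linear.linear[OF sym_matrix_nth_bounded_linear]] by simp
  note T0 = state_tensor_equilibrium[of \<nu>]
  then have in_dom: "(1, 0, 0) \<in> state_domain \<nu>" by (simp add: state_domain_def)
  let ?g = "gaussian_of_state \<nu> v"
  have dif: "?g differentiable (at (1, 0, 0))"
    using Ck_on_gaussian_of_state[of 1 \<nu> v] in_dom by auto
  interpret linear "frechet_derivative ?g (at (1, 0, 0))"
    by (rule linear_frechet_derivative[OF dif])
  have "(?x has_derivative (\<lambda>t. t *\<^sub>R (r, m, g))) (at 0)"
    by (auto intro!: derivative_eq_intros)
  from has_derivative_compose[OF this, of ?g "frechet_derivative ?g (at (1, 0, 0))"] dif
  have "((\<lambda>t. ?g (?x t)) has_derivative
      (\<lambda>t. frechet_derivative ?g (at (1, 0, 0)) (t *\<^sub>R (r, m, g)))) (at 0)"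
    by (simp add: frechet_derivative_works flip: zero_prod_def)
  then have 1: "((\<lambda>t. ?g (?x t)) has_real_derivative partial_deriv ?g (r, m, g) (1, 0, 0)) (at 0)"
    unfolding has_field_derivative_def scaleR real_scaleR_def mult_commute_abs
    by (simp add: partial_deriv_def)
  have "((\<lambda>t. gaussian (1 + t * r) ((1 / (1 + t * r)) *\<^sub>R (t *\<^sub>R m)) (state_tensor \<nu> (?x t)) v)
      has_real_derivative
      maxwellian v * (r + m \<bullet> v + (v \<bullet> ((2 *\<^sub>R sym_matrix g) *v v) - trace (2 *\<^sub>R sym_matrix g)) / 2)) (at 0)"
  proof (rule DERIV_gaussian_mat_1)
    have "?x 0 = (1, 0, 0)" by simp
    then show "state_tensor \<nu> (?x 0) = mat 1" using T0 by (simp only:)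
    show "((\<lambda>t. ((1 / (1 + t * r)) *\<^sub>R (t *\<^sub>R m)) $ i) has_real_derivative m $ i) (at 0)" for i
      by (auto intro!: derivative_eq_intros)
    show "((\<lambda>t. state_tensor \<nu> (?x t) $ i $ j) has_real_derivative (2 *\<^sub>R sym_matrix g) $ i $ j) (at 0)" for i j
    proof -
      \<comment> \<open>\<open>c k\<close> is a component of the velocity along the ray; it is zero
        at \<open>t = 0\<close>, so products of two of them have derivative zero.\<close>
      define c where "c k t = t * m $ k / (1 + t * r)" for k t
      define \<delta> where "\<delta> = (mat 1 :: real^3^3) $ i $ j"
      have c0: "c k 0 = 0" and dc: "(c k has_real_derivative m $ k) (at 0)" for k
        unfolding c_def by (auto intro!: derivative_eq_intros)
      have dI: "((\<lambda>t. 1 / (1 + t * r)) has_real_derivative - r) (at 0)"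
        by (auto intro!: derivative_eq_intros)
      have "((\<lambda>t. (1 / (1 + t * r)) * (2 * (t * sym_matrix g $ i $ j) + (1 + t * r) * \<delta>
          - ((1 - \<nu>) / 3 * (1 + t * r) * (\<Sum>k\<in>UNIV. c k t * c k t)) * \<delta>
          - (\<nu> * (1 + t * r)) * (c i t * c j t))) has_real_derivative 2 * sym_matrix g $ i $ j) (at 0)"
        unfolding sum_3
        by (rule DERIV_cong, (rule dI dc derivative_intros)+) (simp add: c0)
      then show ?thesis
        by (simp add: state_tensor_nth lin c_def \<delta>_def)
    qed
  qed (auto intro!: derivative_eq_intros)
  moreover have "?g (?x t) = gaussian (1 + t * r) ((1 / (1 + t * r)) *\<^sub>R (t *\<^sub>R m)) (state_tensor \<nu> (?x t)) v" for t
    by (simp add: gaussian_of_state_eq)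
  moreover have "v \<bullet> ((2 *\<^sub>R sym_matrix g) *v v) = 2 * (v \<bullet> (sym_matrix g *v v))"
    "trace (2 *\<^sub>R sym_matrix g) = 2 * trace (sym_matrix g)"
    by (simp_all add: scaleR_matrix_vector_assoc[symmetric] trace_def sum_distrib_left)
  ultimately have "((\<lambda>t. ?g (?x t)) has_real_derivative
      maxwellian v * (r + m \<bullet> v + v \<bullet> (sym_matrix g *v v) - trace (sym_matrix g))) (at 0)"
    by (simp add: diff_divide_distrib add_diff_eq)
  from DERIV_unique[OF 1 this] show ?thesis .
qed

subsection \<open>Moments of the Maxwellian\<close>

text \<open>\<open>lborel\<close> is the image of the product of the one-dimensional measures under
  the map \<open>?T\<close> that assembles a vector from its coordinates, so product functions
  integrate by Fubini.\<close>

lemma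
  fixes f :: "'a::euclidean_space \<Rightarrow> real \<Rightarrow> real"
  assumes "\<And>b. b \<in> Basis \<Longrightarrow> integrable lborel (f b)"
  shows integrable_lborel_prod_Basis: "integrable lborel (\<lambda>x. \<Prod>b\<in>Basis. f b (x \<bullet> b))"
    and integral_lborel_prod_Basis:
      "(LINT x|lborel. (\<Prod>b\<in>Basis. f b (x \<bullet> b))) = (\<Prod>b\<in>Basis. LINT x|lborel. f b x)"
proof -
  interpret product_sigma_finite "\<lambda>_::'a. lborel :: real measure" ..
  let ?P = "\<Pi>\<^sub>M b\<in>(Basis :: 'a set). (lborel :: real measure)"
  let ?T = "\<lambda>g. \<Sum>b\<in>Basis. g b *\<^sub>R (b :: 'a)"
  have T: "?T \<in> ?P \<rightarrow>\<^sub>M borel" by measurable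
  have "f b \<in> borel_measurable borel" if "b \<in> Basis" for b
    using borel_measurable_integrable[OF assms[OF that]] by simp
  then have "(\<lambda>x. f b (x \<bullet> b)) \<in> borel_measurable borel" if "b \<in> Basis" for b
    using that by (intro measurable_compose[of "\<lambda>x. x \<bullet> b" borel borel "f b"]) auto
  then have meas: "(\<lambda>x. \<Prod>b\<in>Basis. f b (x \<bullet> b)) \<in> borel_measurable borel"
    by (rule borel_measurable_prod)
  have eq: "(\<Prod>b\<in>Basis. f b (?T g \<bullet> b)) = (\<Prod>b\<in>Basis. f b (g b))" for g
    by (intro prod.cong) (simp_all add: inner_sum_left inner_Basis if_distrib cong: if_cong)
  show "integrable lborel (\<lambda>x. \<Prod>b\<in>Basis. f b (x \<bullet> b))"
    unfolding lborel_eq[where 'a='a] integrable_distr_eq[OF T meas] eq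
    using assms by (intro product_integrable_prod) auto
  show "(LINT x|lborel. (\<Prod>b\<in>Basis. f b (x \<bullet> b))) = (\<Prod>b\<in>Basis. LINT x|lborel. f b x)"
    unfolding lborel_eq[where 'a='a] integral_distr[OF T meas] eq
    using assms by (intro product_integral_prod) auto
qed

lemma prod_Basis_real_3: "(\<Prod>b\<in>Basis. f b) = (\<Prod>i\<in>UNIV. f (axis i (1::real) :: real^3))"
proof -
  have *: "(Basis :: (real^3) set) = (\<lambda>i. axis i 1) ` UNIV" by (auto simp: Basis_vec_def)
  have "inj (\<lambda>i::3. axis i (1::real))" by (auto simp: inj_def axis_eq_axis)
  then show ?thesis unfolding * by (subst prod.reindex) (simp_all add: o_def)
qed

lemma prod_UNIV_3: "prod f (UNIV :: 3 set) = f 1 * f 2 * f 3"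
  unfolding UNIV_3 by (simp add: ac_simps)

lemma maxwellian_eq_prod: "maxwellian v = (\<Prod>i\<in>UNIV. std_normal_density (v $ i))"
proof -
  have "(1 / sqrt (2 * pi))^3 = (2 * pi) powr (- 3 / 2)"
  proof -
    have "1 / sqrt (2 * pi) = (2 * pi) powr (- 1 / 2)"
      by (simp add: powr_minus_divide powr_half_sqrt)
    then have "(1 / sqrt (2 * pi))^3 = ((2 * pi) powr (- 1 / 2)) powr 3"
      by (simp only:) simp
    then show ?thesis unfolding powr_powr by simp
  qed
  then have c: "(2 * pi) powr (- 3 / 2) = (1 / sqrt (2 * pi))^3" by simp
  have "(norm v)\<^sup>2 = (v $ 1)\<^sup>2 + (v $ 2)\<^sup>2 + (v $ 3)\<^sup>2"
    unfolding power2_norm_eq_inner inner_vec_def sum_3 by (simp add: power2_eq_square)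
  then have e: "exp (- (norm v)\<^sup>2 / 2) =
      exp (- (v $ 1)\<^sup>2 / 2) * exp (- (v $ 2)\<^sup>2 / 2) * exp (- (v $ 3)\<^sup>2 / 2)"
    by (simp only: exp_add[symmetric]) (simp add: add_divide_distrib diff_divide_distrib)
  show ?thesis
    unfolding maxwellian_def std_normal_density_def prod_UNIV_3 c e
    by (simp only: power3_eq_cube mult_ac)
qed

lemma maxwellian_monomial_moment:
  fixes n :: "3 \<Rightarrow> nat"
  shows "has_bochner_integral lebesgue (\<lambda>v. maxwellian v * (\<Prod>i\<in>UNIV. v $ i ^ n i))
    (\<Prod>i\<in>UNIV. LINT x|lborel. std_normal_density x * x ^ n i)"
proof -
  \<comment> \<open>The product rule is indexed by basis vectors, the exponents by coordinates;
    \<open>k\<close> reads the coordinate back from the axis vector.\<close>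
  define k where "k b = n (THE i. b = axis i (1::real))" for b :: "real^3"
  let ?f = "\<lambda>(b :: real^3) x. std_normal_density x * x ^ k b"
  have k: "k (axis i 1) = n i" for i by (simp add: k_def axis_eq_axis)
  have eq: "maxwellian v * (\<Prod>i\<in>UNIV. v $ i ^ n i) = (\<Prod>b\<in>Basis. ?f b (v \<bullet> b))" for v
    by (simp add: maxwellian_eq_prod prod_Basis_real_3 k prod.distrib inner_axis)
  have int: "integrable lborel (?f b)" for b by (rule integrable_std_normal_moment)
  have "integrable lborel (\<lambda>v. maxwellian v * (\<Prod>i\<in>UNIV. v $ i ^ n i))"
    unfolding eq using integrable_lborel_prod_Basis[OF int] .
  moreover have "(LINT v|lborel. maxwellian v * (\<Prod>i\<in>UNIV. v $ i ^ n i))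
      = (\<Prod>i\<in>UNIV. LINT x|lborel. std_normal_density x * x ^ n i)"
    unfolding eq integral_lborel_prod_Basis[OF int] by (simp add: prod_Basis_real_3 k)
  \<comment> \<open>Passing from \<open>lborel\<close> to its completion \<open>lebesgue\<close>
    changes neither integrability nor the integral of a Borel function.\<close>
  ultimately show ?thesis
    by (simp add: has_bochner_integral_iff integrable_completion integral_completion
        borel_measurable_integrable)
qed

lemma std_normal_moment_upto_2:
  "(LINT x|lborel. std_normal_density x * x) = 0"
  "(LINT x|lborel. std_normal_density x * x\<^sup>2) = 1"
  using integral_std_normal_moment_odd[of 0] integral_std_normal_moment_even[of 1] by simp_all

lemma maxwellian_mass: "has_bochner_integral lebesgue maxwellian 1"
  using maxwellian_monomial_moment[of "\<lambda>_. 0"] by simp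

lemma maxwellian_first_moment: "has_bochner_integral lebesgue (\<lambda>v. maxwellian v * v $ i) 0"
proof -
  have "(\<Prod>k\<in>UNIV. v $ k ^ (if k = i then 1 else 0)) = v $ i" for v :: "real^3"
    unfolding prod_UNIV_3 using exhaust_3[of i] by (elim disjE) simp_all
  moreover have "(\<Prod>k\<in>UNIV. LINT x|lborel. std_normal_density x * x ^ (if k = i then 1 else 0)) = 0"
    unfolding prod_UNIV_3 using exhaust_3[of i] by (elim disjE) (simp_all add: std_normal_moment_upto_2)
  ultimately show ?thesis
    using maxwellian_monomial_moment[of "\<lambda>k. if k = i then 1 else 0"] by (simp only:)
qed

lemma maxwellian_second_moment:
  "has_bochner_integral lebesgue (\<lambda>v. maxwellian v * (v $ i * v $ j)) (if i = j then 1 else 0)"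
proof -
  \<comment> \<open>The exponents of \<open>v $ i * v $ j\<close>, added so that
    \<open>i = j\<close> yields the square.\<close>
  let ?n = "\<lambda>k. (if k = i then 1 else 0) + (if k = j then 1 else 0) :: nat"
  have "(\<Prod>k\<in>UNIV. v $ k ^ ?n k) = v $ i * v $ j" for v :: "real^3"
    unfolding prod_UNIV_3 using exhaust_3[of i] exhaust_3[of j] by (elim disjE) (simp_all add: power2_eq_square)
  moreover have "(\<Prod>k\<in>UNIV. LINT x|lborel. std_normal_density x * x ^ ?n k) = (if i = j then 1 else 0)"
    unfolding prod_UNIV_3 using exhaust_3[of i] exhaust_3[of j]
    by (elim disjE) (simp_all add: std_normal_moment_upto_2 std_normal_moment_upto_2(2)[unfolded power2_eq_square])
  ultimately show ?thesis
    using maxwellian_monomial_moment[of ?n] by (simp only:)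
qed

subsection \<open>Positivity of the temperature tensor\<close>

definition finite_energy :: "(real^3 \<Rightarrow> real) \<Rightarrow> bool" where
  "finite_energy H \<longleftrightarrow> integrable lebesgue H \<and> integrable lebesgue (\<lambda>w. H w * (norm w)\<^sup>2)"

definition moment1 :: "(real^3 \<Rightarrow> real) \<Rightarrow> 3 \<Rightarrow> real" where
  "moment1 H i = (LINT w|lebesgue. H w * w $ i)"

text \<open>Uncentred, hence linear in the density, unlike \<open>stress_tensor\<close>.\<close>

definition moment2 :: "(real^3 \<Rightarrow> real) \<Rightarrow> 3 \<Rightarrow> 3 \<Rightarrow> real" where
  "moment2 H i j = (LINT w|lebesgue. H w * (w $ i * w $ j))"

lemma moment2_commute: "moment2 H i j = moment2 H j i"
  by (simp add: moment2_def mult.commute)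

lemma borel_measurable_lebesgue_continuous:
  fixes g :: "'a::euclidean_space \<Rightarrow> 'b::real_normed_vector"
  shows "continuous_on UNIV g \<Longrightarrow> g \<in> borel_measurable lebesgue"
  by (intro measurable_completion) (simp add: borel_measurable_continuous_onI)

lemma norm_sq_eq_sum: "(norm (w :: real^3))\<^sup>2 = (\<Sum>i\<in>UNIV. w $ i * w $ i)"
  by (simp add: power2_norm_eq_inner inner_vec_def)

text \<open>Domination: \<open>norm w\<close> is at most \<open>1 + (norm w)^2\<close>, and a
  product of two components is at most \<open>(norm w)^2\<close> in absolute value.\<close>

lemma
  assumes "finite_energy H"
  shows integrable_moment1: "integrable lebesgue (\<lambda>w. H w * w $ i)"
    and integrable_moment2: "integrable lebesgue (\<lambda>w. H w * (w $ i * w $ j))"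
    and integrable_velocity: "integrable lebesgue (\<lambda>w. H w *\<^sub>R w)"
proof -
  have H: "integrable lebesgue H" "integrable lebesgue (\<lambda>w. H w * (norm w)\<^sup>2)"
    using assms by (auto simp: finite_energy_def)
  have [measurable]: "H \<in> borel_measurable lebesgue"
    using H(1) by (rule borel_measurable_integrable)
  have c[measurable]: "(\<lambda>w::real^3. w $ k) \<in> borel_measurable lebesgue" for k
    by (intro borel_measurable_lebesgue_continuous continuous_intros)
  have id[measurable]: "(\<lambda>w::real^3. w) \<in> borel_measurable lebesgue"
    by (intro borel_measurable_lebesgue_continuous continuous_intros)
  have bnd: "integrable lebesgue (\<lambda>w. norm (H w) + norm (H w * (norm w)\<^sup>2))"
    using H by (intro Bochner_Integration.integrable_add integrable_norm)
  have le: "norm w \<le> 1 + (norm w)\<^sup>2" for w :: "real^3"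
    using sum_squares_bound[of "norm w" 1] norm_ge_zero[of w] unfolding mult_1_right power_one by linarith
  have vel: "\<bar>H w\<bar> * norm w \<le> \<bar>H w\<bar> + \<bar>H w\<bar> * (norm w)\<^sup>2" for w
    using mult_left_mono[OF le[of w], of "\<bar>H w\<bar>"] by (simp add: distrib_left)
  show "integrable lebesgue (\<lambda>w. H w *\<^sub>R w)"
    by (rule Bochner_Integration.integrable_bound[OF bnd]) (use vel in \<open>auto simp: abs_mult\<close>)
  show "integrable lebesgue (\<lambda>w. H w * w $ i)"
  proof (rule Bochner_Integration.integrable_bound[OF bnd])
    have "\<bar>H w * w $ i\<bar> \<le> \<bar>H w\<bar> + \<bar>H w\<bar> * (norm w)\<^sup>2" for w
      using order_trans[OF mult_left_mono[OF component_le_norm_cart[of w i], of "\<bar>H w\<bar>"] vel]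
      by (simp add: abs_mult)
    then show "AE w in lebesgue. norm (H w * w $ i) \<le> norm (norm (H w) + norm (H w * (norm w)\<^sup>2))"
      by (auto simp: abs_mult)
  qed auto
  show "integrable lebesgue (\<lambda>w. H w * (w $ i * w $ j))"
  proof (rule Bochner_Integration.integrable_bound[OF H(2)])
    have "\<bar>w $ i\<bar> * \<bar>w $ j\<bar> \<le> (norm w)\<^sup>2" for w :: "real^3"
      unfolding power2_eq_square by (intro mult_mono component_le_norm_cart) auto
    then show "AE w in lebesgue. norm (H w * (w $ i * w $ j)) \<le> norm (H w * (norm w)\<^sup>2)"
      by (auto simp: abs_mult intro!: mult_left_mono)
  qed auto
qed

lemma integral_velocity_nth:
  assumes "finite_energy H"
  shows "(LINT w|lebesgue. H w *\<^sub>R w) $ i = moment1 H i"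
  using integral_bounded_linear[OF bounded_linear_vec_nth integrable_velocity[OF assms], of i]
  by (simp add: moment1_def)

lemma integral_energy:
  assumes "finite_energy H"
  shows "(LINT w|lebesgue. H w * (norm w)\<^sup>2) = (\<Sum>i\<in>UNIV. moment2 H i i)"
  unfolding moment2_def norm_sq_eq_sum sum_distrib_left
  by (rule Bochner_Integration.integral_sum) (rule integrable_moment2[OF assms])

lemma finite_energy_maxwellian: "finite_energy maxwellian"
proof -
  have "integrable lebesgue (\<lambda>w. \<Sum>i\<in>UNIV. maxwellian w * (w $ i * w $ i))"
    using maxwellian_second_moment by (intro Bochner_Integration.integrable_sum) (auto simp: has_bochner_integral_iff)
  then show ?thesis
    using maxwellian_mass unfolding finite_energy_def norm_sq_eq_sum sum_distrib_left
    by (simp add: has_bochner_integral_iff)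
qed

lemma maxwellian_moments:
  "mass_density maxwellian = 1" "moment1 maxwellian i = 0"
  "moment2 maxwellian i j = (if i = j then 1 else 0)"
  using maxwellian_mass maxwellian_first_moment[of i] maxwellian_second_moment[of i j]
  by (auto simp: mass_density_def moment1_def moment2_def has_bochner_integral_iff)

lemma
  assumes "finite_energy F" "finite_energy H"
  shows finite_energy_comb: "finite_energy (\<lambda>w. a * F w + b * H w)"
    and mass_density_comb: "mass_density (\<lambda>w. a * F w + b * H w) = a * mass_density F + b * mass_density H"
    and moment1_comb: "moment1 (\<lambda>w. a * F w + b * H w) i = a * moment1 F i + b * moment1 H i"
    and moment2_comb: "moment2 (\<lambda>w. a * F w + b * H w) i j = a * moment2 F i j + b * moment2 H i j"
  using assms integrable_moment1[OF assms(1)] integrable_moment1[OF assms(2)]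
    integrable_moment2[OF assms(1)] integrable_moment2[OF assms(2)]
  by (simp_all add: finite_energy_def mass_density_def moment1_def moment2_def distrib_right mult.assoc)

text \<open>Once \<open>\<rho> U\<close> is known to be the first moment, expanding the centred
  product gives two cross terms \<open>- \<rho> U_i U_j\<close> and one term
  \<open>+ \<rho> U_i U_j\<close>.\<close>

lemma
  assumes "finite_energy F" "mass_density F \<noteq> 0"
  shows mass_bulk_velocity: "mass_density F * bulk_velocity F $ i = moment1 F i"
    and mass_stress_tensor: "mass_density F * stress_tensor F $ i $ j
      = moment2 F i j - mass_density F * (bulk_velocity F $ i * bulk_velocity F $ j)"
    and temperature_eq_trace: "3 * temperature F = (\<Sum>i\<in>UNIV. stress_tensor F $ i $ i)"
proof -
  let ?\<rho> = "mass_density F" and ?U = "bulk_velocity F"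
  have F: "integrable lebesgue F" using assms(1) by (simp add: finite_energy_def)
  note int = F integrable_moment1[OF assms(1)] integrable_moment2[OF assms(1)]
  show m: "?\<rho> * ?U $ i = moment1 F i" for i
    using assms integral_velocity_nth[OF assms(1), of i] by (simp add: bulk_velocity_def)
  have expand: "F w * outer (w - ?U) (w - ?U) $ i $ j
      = F w * (w $ i * w $ j) - ?U $ i * (F w * w $ j) - ?U $ j * (F w * w $ i) + (?U $ i * ?U $ j) * F w"
    for w i j by (simp add: outer_def algebra_simps)
  have out: "integrable lebesgue (\<lambda>w. F w * outer (w - ?U) (w - ?U) $ i $ j)" for i j
    unfolding expand using int by simp
  have "(LINT w|lebesgue. F w * outer (w - ?U) (w - ?U) $ i $ j)
      = moment2 F i j - ?U $ i * moment1 F j - ?U $ j * moment1 F i + (?U $ i * ?U $ j) * ?\<rho>" for i j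
    unfolding expand using int by (simp add: moment1_def moment2_def mass_density_def)
  also have "\<dots> i j = moment2 F i j - ?\<rho> * (?U $ i * ?U $ j)" for i j
    unfolding m[symmetric] by (simp add: algebra_simps)
  finally show "?\<rho> * stress_tensor F $ i $ j = moment2 F i j - ?\<rho> * (?U $ i * ?U $ j)"
    using assms(2) by (simp add: stress_tensor_def)
  have "F w * (norm (w - ?U))\<^sup>2 = (\<Sum>i\<in>UNIV. F w * outer (w - ?U) (w - ?U) $ i $ i)" for w
    by (simp add: norm_sq_eq_sum outer_def sum_distrib_left)
  then show "3 * temperature F = (\<Sum>i\<in>UNIV. stress_tensor F $ i $ i)"
    using out by (simp add: temperature_def stress_tensor_def sum_divide_distrib sum_distrib_left)
qed

section \<open>The matrix G in terms of the second moments\<close>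

definition G_of :: "real \<Rightarrow> (real^3 \<Rightarrow> real) \<Rightarrow> real^3^3" where
  "G_of \<nu> F = G_matrix \<nu> (mass_density F) (bulk_velocity F) (temperature F) (stress_tensor F)"

text \<open>The velocity drops out: \<open>3 \<rho> T + \<rho> |U|^2\<close> is the total second
  moment and \<open>\<rho> \<Theta> + \<rho> U \<otimes> U\<close> the uncentred matrix. Hence
  \<open>G\<close> is linear in \<open>F\<close>, which the mixture argument rests on.\<close>

lemma G_of_nth:
  assumes "finite_energy F" "mass_density F \<noteq> 0"
  shows "G_of \<nu> F $ i $ j = ((1 - \<nu>) / 6 * (\<Sum>k\<in>UNIV. moment2 F k k) - mass_density F / 2) * (mat 1 :: real^3^3) $ i $ j
    + \<nu> / 2 * moment2 F i j"
proof -
  let ?\<rho> = "mass_density F" and ?U = "bulk_velocity F"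
  note st = mass_stress_tensor[OF assms]
  have "3 * ?\<rho> * temperature F = (\<Sum>k\<in>UNIV. ?\<rho> * stress_tensor F $ k $ k)"
    using temperature_eq_trace[OF assms] by (simp add: mult.left_commute[of 3] mult.assoc sum_distrib_left)
  also have "\<dots> = (\<Sum>k\<in>UNIV. moment2 F k k) - ?\<rho> * (norm ?U)\<^sup>2"
    unfolding st by (simp add: sum_subtractf sum_distrib_left norm_sq_eq_sum)
  finally have E: "3 * ?\<rho> * temperature F + ?\<rho> * (norm ?U)\<^sup>2 = (\<Sum>k\<in>UNIV. moment2 F k k)" by simp
  have P: "?\<rho> * stress_tensor F $ i $ j + ?\<rho> * (?U $ i * ?U $ j) = moment2 F i j"
    by (simp add: st)
  show ?thesis
    unfolding G_of_def G_matrix_def E P[symmetric] by (simp add: outer_def algebra_simps)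
qed

lemma G_of_symmetric:
  assumes "finite_energy F" "mass_density F \<noteq> 0"
  shows "transpose (G_of \<nu> F) = G_of \<nu> F"
  by (simp add: vec_eq_iff transpose_def G_of_nth[OF assms] moment2_commute[of F _ _] mat_def)

lemma sym_matrix_G_coords:
  assumes "finite_energy F" "mass_density F \<noteq> 0"
  shows "sym_matrix (G_coords \<nu> F) = G_of \<nu> F"
  using sym_matrix_sym_coords[OF G_of_symmetric[OF assms]] by (simp add: G_coords_def G_of_def)

section \<open>Positive definiteness and positive determinant\<close>

text \<open>Every matrix on the segment from the identity to \<open>A\<close> has a positive
  quadratic form, hence trivial kernel; the determinant starts at 1 and cannot cross zero.\<close>

lemma det_pos_if_pos_def:
  fixes A :: "real^3^3"
  assumes "\<And>x. x \<noteq> 0 \<Longrightarrow> 0 < x \<bullet> (A *v x)"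
  shows "0 < det A"
proof (rule ccontr)
  let ?B = "\<lambda>t. t *\<^sub>R A + (1 - t) *\<^sub>R mat 1"
  assume "\<not> 0 < det A"
  then have "det (?B 1) \<le> 0" by simp
  moreover have "0 \<le> det (?B 0)" by simp
  moreover have "continuous_on {0..1} (\<lambda>t. det (?B t))"
    unfolding det_3 by (intro continuous_intros)
  ultimately obtain t where t: "0 \<le> t" "t \<le> 1" "det (?B t) = 0"
    using IVT2'[of "\<lambda>t. det (?B t)" 1 0 0] by auto
  from t(3) obtain x where x: "x \<noteq> 0" "?B t *v x = 0"
    using matrix_left_invertible_ker[of "?B t"] invertible_left_inverse[of "?B t"]
      invertible_det_nz[of "?B t"] by auto
  have "0 = x \<bullet> (?B t *v x)" using x(2) by simp
  also have "\<dots> = t * (x \<bullet> (A *v x)) + (1 - t) * (x \<bullet> x)"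
    by (simp add: matrix_vector_mult_add_rdistrib inner_add_right flip: scaleR_matrix_vector_assoc)
  also have "\<dots> > 0"
  proof (cases "t = 0")
    case False
    then show ?thesis using t assms[OF x(1)] by (intro add_pos_nonneg mult_pos_pos mult_nonneg_nonneg) auto
  qed (use x(1) in simp)
  finally show False by simp
qed

text \<open>The density against which \<open>F\<close> is integrated in \<open>\<rho> x\<^sup>T \<T>\<^sub>\<nu> x\<close>. The bound on \<open>\<nu>\<close>
  is exactly what the Cauchy-Schwarz inequality needs to make it positive.\<close>

definition ellipsoidal_form :: "real \<Rightarrow> real^3 \<Rightarrow> real^3 \<Rightarrow> real" where
  "ellipsoidal_form \<nu> x y = (1 - \<nu>) / 3 * ((norm x)\<^sup>2 * (norm y)\<^sup>2) + \<nu> * (x \<bullet> y)\<^sup>2"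

text \<open>For \<open>\<nu> \<ge> 0\<close> the second term is dropped. For
  \<open>\<nu> < 0\<close> Cauchy-Schwarz bounds it below by \<open>\<nu>\<close> times the product
  of squared norms, and \<open>(1 - \<nu>) / 3 + \<nu> = (1 + 2 \<nu>) / 3\<close>.\<close>

lemma ellipsoidal_form_lower:
  assumes "- 1 / 2 < \<nu>" "\<nu> < 1"
  shows "min (1 - \<nu>) (1 + 2 * \<nu>) / 3 * ((norm x)\<^sup>2 * (norm y)\<^sup>2) \<le> ellipsoidal_form \<nu> x y"
proof -
  let ?n = "(norm x)\<^sup>2 * (norm y)\<^sup>2"
  have cs: "(x \<bullet> y)\<^sup>2 \<le> ?n"
    using Cauchy_Schwarz_ineq[of x y] by (simp add: power2_norm_eq_inner)
  show ?thesis
  proof (cases "0 \<le> \<nu>")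
    case True
    then have "min (1 - \<nu>) (1 + 2 * \<nu>) = 1 - \<nu>" by simp
    moreover have "0 \<le> \<nu> * (x \<bullet> y)\<^sup>2" using True by simp
    ultimately show ?thesis by (simp add: ellipsoidal_form_def)
  next
    case False
    then have "min (1 - \<nu>) (1 + 2 * \<nu>) = 1 + 2 * \<nu>" by simp
    moreover have "\<nu> * ?n \<le> \<nu> * (x \<bullet> y)\<^sup>2"
      using cs False by (intro mult_left_mono_neg) auto
    moreover have "(1 + 2 * \<nu>) / 3 * ?n = (1 - \<nu>) / 3 * ?n + \<nu> * ?n" by (simp add: field_simps)
    ultimately show ?thesis by (simp add: ellipsoidal_form_def)
  qed
qed

lemma mass_temp_tensor_form:
  assumes "finite_energy F" "mass_density F \<noteq> 0"
  shows "integrable lebesgue (\<lambda>w. F w * ellipsoidal_form \<nu> x (w - bulk_velocity F))"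
    and "mass_density F * (x \<bullet> (temp_tensor \<nu> (temperature F) (stress_tensor F) *v x))
    = (LINT w|lebesgue. F w * ellipsoidal_form \<nu> x (w - bulk_velocity F))"
proof -
  let ?\<rho> = "mass_density F" and ?U = "bulk_velocity F"
  let ?O = "\<lambda>i j w. F w * outer (w - ?U) (w - ?U) $ i $ j"
  have "?O i j w
      = F w * (w $ i * w $ j) - ?U $ i * (F w * w $ j) - ?U $ j * (F w * w $ i) + (?U $ i * ?U $ j) * F w"
    for w i j by (simp add: outer_def algebra_simps)
  then have int: "integrable lebesgue (?O i j)" for i j
    using assms(1) integrable_moment1[OF assms(1)] integrable_moment2[OF assms(1)]
    by (simp add: finite_energy_def)
  have st: "?\<rho> * stress_tensor F $ i $ j = (LINT w|lebesgue. ?O i j w)" for i j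
    using assms(2) by (simp add: stress_tensor_def)
  have tr: "?\<rho> * temperature F = (1/3) * (\<Sum>i\<in>UNIV. LINT w|lebesgue. ?O i i w)"
    using temperature_eq_trace[OF assms] unfolding st[symmetric] sum_distrib_left[symmetric] by simp
  \<comment> \<open>With the centred products \<open>?O\<close> the form becomes a finite linear
    combination: its first term gives the temperature, its second the stress tensor.\<close>
  have form: "F w * ellipsoidal_form \<nu> x (w - ?U) = ((1 - \<nu>) / 3 * (norm x)\<^sup>2) * (\<Sum>i\<in>UNIV. ?O i i w)
      + \<nu> * (\<Sum>i\<in>UNIV. \<Sum>j\<in>UNIV. x $ i * x $ j * ?O i j w)" for w
    unfolding ellipsoidal_form_def norm_sq_eq_sum inner_vec_def sum_3 outer_def
    by (simp add: power2_eq_square algebra_simps)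
  show "integrable lebesgue (\<lambda>w. F w * ellipsoidal_form \<nu> x (w - bulk_velocity F))"
    unfolding form using int by simp
  have "(LINT w|lebesgue. F w * ellipsoidal_form \<nu> x (w - ?U))
      = ((1 - \<nu>) / 3 * (norm x)\<^sup>2) * (\<Sum>i\<in>UNIV. LINT w|lebesgue. ?O i i w)
      + \<nu> * (\<Sum>i\<in>UNIV. \<Sum>j\<in>UNIV. x $ i * x $ j * (LINT w|lebesgue. ?O i j w))"
    unfolding form using int by simp
  also have "\<dots> = (1 - \<nu>) * (norm x)\<^sup>2 * (?\<rho> * temperature F)
      + \<nu> * (\<Sum>i\<in>UNIV. \<Sum>j\<in>UNIV. x $ i * x $ j * (?\<rho> * stress_tensor F $ i $ j))"
    unfolding tr st by simp
  also have "\<dots> = ?\<rho> * (x \<bullet> (temp_tensor \<nu> (temperature F) (stress_tensor F) *v x))"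
    unfolding temp_tensor_def norm_sq_eq_sum inner_vec_def sum_3 matrix_vector_mult_def mat_def
    by (simp add: sum_3 algebra_simps)
  finally show "?\<rho> * (x \<bullet> (temp_tensor \<nu> (temperature F) (stress_tensor F) *v x))
    = (LINT w|lebesgue. F w * ellipsoidal_form \<nu> x (w - ?U))" ..
qed

text \<open>For \<open>x \<noteq> 0\<close> the form vanishes at most at the single velocity
  \<open>U\<close>, a null set. A zero integral would thus make \<open>F\<close> vanish almost
  everywhere, against positive mass.\<close>

lemma temp_tensor_det_pos:
  assumes nu: "- 1 / 2 < \<nu>" "\<nu> < 1"
    and F: "finite_energy F" "AE w in lebesgue. 0 \<le> F w" "0 < mass_density F"
  shows "0 < det (temp_tensor \<nu> (temperature F) (stress_tensor F))"
proof (rule det_pos_if_pos_def)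
  fix x :: "real^3"
  assume "x \<noteq> 0"
  let ?U = "bulk_velocity F"
  let ?q = "\<lambda>w. ellipsoidal_form \<nu> x (w - ?U)"
  have \<rho>: "mass_density F \<noteq> 0" using F(3) by simp
  note int = mass_temp_tensor_form(1)[OF F(1) \<rho>, of \<nu> x]
  have q: "0 \<le> ?q w" "w \<noteq> ?U \<Longrightarrow> 0 < ?q w" for w
  proof -
    have k: "0 < min (1 - \<nu>) (1 + 2 * \<nu>) / 3" using nu by simp
    then have "0 \<le> min (1 - \<nu>) (1 + 2 * \<nu>) / 3 * ((norm x)\<^sup>2 * (norm (w - ?U))\<^sup>2)"
      by (intro mult_nonneg_nonneg) auto
    then show "0 \<le> ?q w" using ellipsoidal_form_lower[OF nu, of x "w - ?U"] by linarith
    assume "w \<noteq> ?U"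
    then have "0 < min (1 - \<nu>) (1 + 2 * \<nu>) / 3 * ((norm x)\<^sup>2 * (norm (w - ?U))\<^sup>2)"
      using k \<open>x \<noteq> 0\<close> by (intro mult_pos_pos) auto
    then show "0 < ?q w" using ellipsoidal_form_lower[OF nu, of x "w - ?U"] by linarith
  qed
  have nonneg: "AE w in lebesgue. 0 \<le> F w * ?q w"
    using F(2) by eventually_elim (simp add: q(1))
  have "(LINT w|lebesgue. F w * ?q w) \<noteq> 0"
  proof
    assume "(LINT w|lebesgue. F w * ?q w) = 0"
    then have "AE w in lebesgue. F w * ?q w = 0"
      using integral_nonneg_eq_0_iff_AE[OF int nonneg] by simp
    moreover have "AE w in lebesgue. w \<noteq> ?U"
      by (rule AE_I[of _ _ "{?U}"]) auto
    ultimately have "AE w in lebesgue. F w = 0"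
      by eventually_elim (use q(2) in fastforce)
    then have "mass_density F = 0"
      unfolding mass_density_def by (rule integral_eq_zero_AE)
    with F(3) show False by simp
  qed
  moreover have "0 \<le> (LINT w|lebesgue. F w * ?q w)"
    using nonneg by (rule integral_nonneg_AE)
  ultimately have "0 < mass_density F * (x \<bullet> (temp_tensor \<nu> (temperature F) (stress_tensor F) *v x))"
    unfolding mass_temp_tensor_form(2)[OF F(1) \<rho>] by simp
  then show "0 < x \<bullet> (temp_tensor \<nu> (temperature F) (stress_tensor F) *v x)"
    using F(3) by (simp add: zero_less_mult_iff)
qed

subsection \<open>Transitional states and the expansion\<close>

definition state_of :: "real \<Rightarrow> (real^3 \<Rightarrow> real) \<Rightarrow> real \<times> (real^3) \<times> (real^6)" where
  "state_of \<nu> F = (mass_density F, mass_density F *\<^sub>R bulk_velocity F, G_coords \<nu> F)"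

lemma state_tensor_state_of:
  assumes "finite_energy F" "mass_density F \<noteq> 0"
  shows "state_tensor \<nu> (state_of \<nu> F) = temp_tensor \<nu> (temperature F) (stress_tensor F)"
  using assms(2) temp_tensor_of_G_matrix[OF assms(2)]
  by (simp add: state_tensor_def state_of_def sym_matrix_G_coords[OF assms] G_of_def)

lemma state_of_in_domain:
  assumes "- 1 / 2 < \<nu>" "\<nu> < 1"
    and "finite_energy F" "AE w in lebesgue. 0 \<le> F w" "0 < mass_density F"
  shows "state_of \<nu> F \<in> state_domain \<nu>"
  using temp_tensor_det_pos[OF assms] assms(5) state_tensor_state_of[OF assms(3), of \<nu>]
  by (simp add: state_domain_def) (simp add: state_of_def)

lemma gaussian_of_state_state_of:
  assumes "finite_energy F" "mass_density F \<noteq> 0"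
  shows "gaussian_of_state \<nu> v (state_of \<nu> F) = ellipsoidal_gaussian \<nu> F v"
  unfolding gaussian_of_state_eq state_tensor_state_of[OF assms] ellipsoidal_gaussian_def
  using assms(2) by (simp add: state_of_def)

text \<open>Neither \<open>U\<close> nor \<open>\<Theta>\<close> is linear in the density, but
  \<open>\<rho>\<close>, \<open>\<rho> U\<close> and \<open>G\<close> are, so the comparison is made
  on moments.\<close>

lemma transitional_state_eq_state_of_mixture:
  assumes F: "finite_energy F" "0 < mass_density F" and \<theta>: "\<theta> \<in> {0..1}"
  shows "transitional_state \<nu> F \<theta> = state_of \<nu> (\<lambda>w. \<theta> * F w + (1 - \<theta>) * maxwellian w)"
proof -
  let ?F = "\<lambda>w. \<theta> * F w + (1 - \<theta>) * maxwellian w"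
  have fe: "finite_energy ?F" by (intro finite_energy_comb F(1) finite_energy_maxwellian)
  have \<rho>: "mass_density ?F = \<theta> * mass_density F + (1 - \<theta>)"
    by (simp add: mass_density_comb[OF F(1) finite_energy_maxwellian] maxwellian_moments)
  have pos: "0 < mass_density ?F"
  \<comment> \<open>Strict positivity comes from the share \<open>1 - \<theta>\<close> of the
    Maxwellian, and at \<open>\<theta> = 1\<close> from \<open>F\<close>.\<close>
  proof (cases "\<theta> = 1")
    case False
    then show ?thesis unfolding \<rho> using F(2) \<theta> by (intro add_nonneg_pos mult_nonneg_nonneg) auto
  qed (use F(2) \<rho> in simp)
  then have nz: "mass_density ?F \<noteq> 0" and nzF: "mass_density F \<noteq> 0" using F(2) by auto
  have "mass_density ?F *\<^sub>R bulk_velocity ?F = \<theta> *\<^sub>R (mass_density F *\<^sub>R bulk_velocity F)"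
    using mass_bulk_velocity[OF fe nz] mass_bulk_velocity[OF F(1) nzF]
    by (simp add: vec_eq_iff moment1_comb[OF F(1) finite_energy_maxwellian] maxwellian_moments)
  \<comment> \<open>The Maxwellian contributes nothing to \<open>G\<close>: its diagonal entries are
    \<open>(1 - \<nu>) / 6 * 3 - 1 / 2 + \<nu> / 2 = 0\<close>.\<close>
  moreover have "G_of \<nu> ?F = \<theta> *\<^sub>R G_of \<nu> F"
    unfolding vec_eq_iff vector_scaleR_component G_of_nth[OF fe nz] G_of_nth[OF F(1) nzF] \<rho>
      moment2_comb[OF F(1) finite_energy_maxwellian] maxwellian_moments sum_3
    by (auto simp: mat_def field_simps)
  then have "G_coords \<nu> ?F = \<theta> *\<^sub>R G_coords \<nu> F"
    unfolding G_coords_def G_of_def[symmetric]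
    by (auto simp: sym_coords_def vec_eq_iff vector_def)
  ultimately show ?thesis
    by (simp add: transitional_state_def state_of_def \<rho>)
qed

section \<open>The first-order term and the projection\<close>

text \<open>The coefficients of \<open>P_nu\<close> are moments of \<open>F\<close> minus the
  Maxwellian. In \<open>v \<bullet> G v - trace G\<close> the part free of \<open>\<nu>\<close> is
  the energy mode of \<open>P0\<close>; the rest is \<open>\<nu> / 2\<close> times the trace-free
  part of the second moment, whose diagonal gives \<open>P1\<close> and whose off-diagonal entries
  give \<open>P2\<close>.\<close>

lemma P_nu_eq:
  fixes F f :: "real^3 \<Rightarrow> real"
  assumes F_f: "\<And>w. F w = maxwellian w + sqrt (maxwellian w) * f w"
    and F: "finite_energy F" "mass_density F \<noteq> 0"
  shows "P_nu \<nu> f v * sqrt (maxwellian v) = maxwellian v *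
    (mass_density F - 1 + (mass_density F *\<^sub>R bulk_velocity F) \<bullet> v
      + v \<bullet> (G_of \<nu> F *v v) - trace (G_of \<nu> F))"
proof -
  \<comment> \<open>The coefficients \<open>1\<close> and \<open>- 1\<close> are kept explicit so
    that the rules for linear combinations match.\<close>
  define H where "H = (\<lambda>w. 1 * F w + (- 1) * maxwellian w)"
  have H: "finite_energy H" unfolding H_def by (intro finite_energy_comb F(1) finite_energy_maxwellian)
  have fH: "f w * sqrt (maxwellian w) = H w" for w by (simp add: F_f H_def)
  define \<rho> where "\<rho> = mass_density F"
  define m where "m = moment1 F"
  define P where "P = moment2 F"
  define E where "E = (\<Sum>i\<in>UNIV. P i i)"
  define s where "s = sqrt (maxwellian v)"
  have sq: "maxwellian v = s * s"
    by (simp add: s_def maxwellian_def)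
  \<comment> \<open>Each normalising constant occurs twice, in the coefficient and in the
    mode.\<close>
  have r6: "a / sqrt 6 * (b / sqrt 6) = a * b / 6"
    and r18: "a / (3 * sqrt 2) * (b / (3 * sqrt 2)) = a * b / 18" for a b :: real
    by simp_all
  have intH: "integrable lebesgue H" "integrable lebesgue (\<lambda>w. H w * (norm w)\<^sup>2)"
    using H by (auto simp: finite_energy_def)
  have mH: "mass_density H = \<rho> - 1" "moment1 H i = m i"
    "moment2 H i j = P i j - (if i = j then 1 else 0)" for i j
    unfolding H_def
    using mass_density_comb[OF F(1) finite_energy_maxwellian, of 1 "- 1"]
      moment1_comb[OF F(1) finite_energy_maxwellian, of 1 "- 1"]
      moment2_comb[OF F(1) finite_energy_maxwellian, of 1 "- 1"]
    by (simp_all only: maxwellian_moments \<rho>_def m_def P_def)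
  have energyH: "(LINT w|lebesgue. H w * (norm w)\<^sup>2) = E - 3"
    unfolding integral_energy[OF H] mH E_def by (simp add: sum_subtractf)
  have I0: "(LINT w|lebesgue. f w * sqrt (maxwellian w)) = \<rho> - 1"
    unfolding fH mH(1)[symmetric] mass_density_def ..
  have I1: "(LINT w|lebesgue. (f w * sqrt (maxwellian w)) *\<^sub>R w) \<bullet> v = (\<Sum>i\<in>UNIV. m i * v $ i)"
    unfolding fH inner_vec_def integral_velocity_nth[OF H] mH by simp
  have I2: "(LINT w|lebesgue. f w * (((norm w)\<^sup>2 - 3) / sqrt 6) * sqrt (maxwellian w))
      = (E - 3 * \<rho>) / sqrt 6"
  proof -
    have "f w * (((norm w)\<^sup>2 - 3) / sqrt 6) * sqrt (maxwellian w)
        = (H w * (norm w)\<^sup>2 - 3 * H w) / sqrt 6" for w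
      unfolding fH[symmetric] by (simp add: algebra_simps diff_divide_distrib)
    then have "(LINT w|lebesgue. f w * (((norm w)\<^sup>2 - 3) / sqrt 6) * sqrt (maxwellian w))
        = ((LINT w|lebesgue. H w * (norm w)\<^sup>2) - 3 * mass_density H) / sqrt 6"
      unfolding mass_density_def using intH by (simp only:) simp
    then show ?thesis unfolding energyH mH by simp
  qed
  have I3: "(LINT w|lebesgue. f w * ((3 * (w $ i)\<^sup>2 - (norm w)\<^sup>2) / (3 * sqrt 2)) * sqrt (maxwellian w))
      = (3 * P i i - E) / (3 * sqrt 2)" for i
  proof -
    have "f w * ((3 * (w $ i)\<^sup>2 - (norm w)\<^sup>2) / (3 * sqrt 2)) * sqrt (maxwellian w)
        = (3 * (H w * (w $ i * w $ i)) - H w * (norm w)\<^sup>2) / (3 * sqrt 2)" for w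
      unfolding fH[symmetric] by (simp add: algebra_simps diff_divide_distrib power2_eq_square)
    then have "(LINT w|lebesgue. f w * ((3 * (w $ i)\<^sup>2 - (norm w)\<^sup>2) / (3 * sqrt 2)) * sqrt (maxwellian w))
        = (3 * moment2 H i i - (LINT w|lebesgue. H w * (norm w)\<^sup>2)) / (3 * sqrt 2)"
      unfolding moment2_def using intH integrable_moment2[OF H] by (simp only:) simp
    then show ?thesis unfolding energyH mH by simp
  qed
  \<comment> \<open>Off the diagonal the Maxwellian has no second moment, so \<open>F\<close> alone
    contributes.\<close>
  have I4: "(LINT w|lebesgue. f w * (w $ i) * (w $ j) * sqrt (maxwellian w)) = P i j" if "i \<noteq> j" for i j
  proof -
    have "f w * (w $ i) * (w $ j) * sqrt (maxwellian w) = H w * (w $ i * w $ j)" for w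
      unfolding fH[symmetric] by (simp add: algebra_simps)
    then show ?thesis using mH(3)[of i j] that by (simp only: moment2_def) simp
  qed
  have p0: "P0 f v * sqrt (maxwellian v) = maxwellian v *
      (\<rho> - 1 + (\<Sum>i\<in>UNIV. m i * v $ i) + (E - 3 * \<rho>) * ((norm v)\<^sup>2 - 3) / 6)"
    unfolding P0_def I0 I1 I2 r6 s_def[symmetric] unfolding sq by (simp only: algebra_simps)
  have p1: "P1 f v * sqrt (maxwellian v) = maxwellian v *
      (\<Sum>i\<in>UNIV. (3 * P i i - E) * (3 * (v $ i)\<^sup>2 - (norm v)\<^sup>2) / 18)"
    unfolding P1_def I3 r18 s_def[symmetric] unfolding sq sum_distrib_left sum_distrib_right
    by (intro sum.cong refl) (simp only: mult_ac)
  have p2: "P2 f v * sqrt (maxwellian v) = maxwellian v *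
      (P 1 2 * v $ 1 * v $ 2 + P 2 3 * v $ 2 * v $ 3 + P 3 1 * v $ 3 * v $ 1)"
    unfolding P2_def s_def[symmetric] unfolding sq by (simp add: I4) (simp add: algebra_simps)
  have "P_nu \<nu> f v * sqrt (maxwellian v) = maxwellian v *
    ((\<rho> - 1 + (\<Sum>i\<in>UNIV. m i * v $ i) + (E - 3 * \<rho>) * ((norm v)\<^sup>2 - 3) / 6)
      + \<nu> * ((\<Sum>i\<in>UNIV. (3 * P i i - E) * (3 * (v $ i)\<^sup>2 - (norm v)\<^sup>2) / 18)
        + (P 1 2 * v $ 1 * v $ 2 + P 2 3 * v $ 2 * v $ 3 + P 3 1 * v $ 3 * v $ 1)))"
    unfolding P_nu_def distrib_right mult.assoc p0 p1 p2 by (simp only: distrib_left mult_ac)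
  also have "(\<Sum>i\<in>UNIV. m i * v $ i) = (mass_density F *\<^sub>R bulk_velocity F) \<bullet> v"
    using mass_bulk_velocity[OF F] by (simp add: inner_vec_def m_def)
  also have "(\<rho> - 1 + (mass_density F *\<^sub>R bulk_velocity F) \<bullet> v + (E - 3 * \<rho>) * ((norm v)\<^sup>2 - 3) / 6)
      + \<nu> * ((\<Sum>i\<in>UNIV. (3 * P i i - E) * (3 * (v $ i)\<^sup>2 - (norm v)\<^sup>2) / 18)
        + (P 1 2 * v $ 1 * v $ 2 + P 2 3 * v $ 2 * v $ 3 + P 3 1 * v $ 3 * v $ 1))
      = mass_density F - 1 + (mass_density F *\<^sub>R bulk_velocity F) \<bullet> v
      + v \<bullet> (G_of \<nu> F *v v) - trace (G_of \<nu> F)"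
  proof -
    have G: "G_of \<nu> F $ i $ j = ((1 - \<nu>) / 6 * E - \<rho> / 2) * (if i = j then 1 else 0) + \<nu> / 2 * P i j" for i j
      by (simp add: G_of_nth[OF F] E_def P_def \<rho>_def mat_def)
    have sym: "P 2 1 = P 1 2" "P 3 2 = P 2 3" "P 1 3 = P 3 1"
      by (simp_all add: P_def moment2_commute)
    \<comment> \<open>Each off-diagonal pair of \<open>G\<close> counts twice with factor
      \<open>\<nu> / 2\<close>, giving coefficient \<open>\<nu>\<close> on the three products of
      \<open>P2\<close>.\<close>
    have "v \<bullet> (G_of \<nu> F *v v) - trace (G_of \<nu> F) = (E - 3 * \<rho>) * ((norm v)\<^sup>2 - 3) / 6
      + \<nu> * ((\<Sum>i\<in>UNIV. (3 * P i i - E) * (3 * (v $ i)\<^sup>2 - (norm v)\<^sup>2) / 18)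
        + (P 1 2 * v $ 1 * v $ 2 + P 2 3 * v $ 2 * v $ 3 + P 3 1 * v $ 3 * v $ 1))"
      unfolding inner_vec_def matrix_vector_mult_def trace_def norm_sq_eq_sum vec_lambda_beta sum_3 G E_def
      by (simp add: sym power2_eq_square field_simps)
    then show ?thesis by (simp add: \<rho>_def)
  qed
  finally show ?thesis .
qed

text \<open>The double sum runs over all ten scalar coordinates of
  \<open>(\<rho>, \<rho> U, G)\<close>. The remainder weight is the first power of
  \<open>1 - \<theta>\<close>, as the integral form with second derivatives dictates: for the
  function \<open>\<theta>^2\<close> the remainder is 1, whereas the weight
  \<open>(1 - \<theta>)^2\<close> would give 2/3.\<close>

theorem theorem2p3:
  fixes \<nu> :: real and F f :: "real^3 \<Rightarrow> real" and v :: "real^3"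
  assumes nu: "- 1 / 2 < \<nu>" "\<nu> < 1"
    and F_f: "\<And>w. F w = maxwellian w + sqrt (maxwellian w) * f w"
    and F_nonneg: "AE w in lebesgue. 0 \<le> F w"
    and F_mass: "integrable lebesgue F"
    and F_energy: "integrable lebesgue (\<lambda>w. F w * (norm w)\<^sup>2)"
    and F_pos: "0 < mass_density F"
  shows "(\<forall>\<theta>\<in>{0..1}.
            twice_differentiable_at (gaussian_of_state \<nu> v) (transitional_state \<nu> F \<theta>))
       \<and> (\<forall>a\<in>Basis. \<forall>b\<in>Basis.
            (\<lambda>\<theta>. hessian_entry (gaussian_of_state \<nu> v) (transitional_state \<nu> F \<theta>) a b
                  * (1 - \<theta>)) integrable_on {0..1})
       \<and> ellipsoidal_gaussian \<nu> F v =
            maxwellian v + P_nu \<nu> f v * sqrt (maxwellian v)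
            + (\<Sum>a\<in>Basis. \<Sum>b\<in>Basis.
                 integral {0..1}
                   (\<lambda>\<theta>. hessian_entry (gaussian_of_state \<nu> v) (transitional_state \<nu> F \<theta>) a b
                         * (1 - \<theta>))
                 * (state_deviation \<nu> F \<bullet> a) * (state_deviation \<nu> F \<bullet> b))"
proof -
  let ?g = "gaussian_of_state \<nu> v"
  let ?d = "state_deviation \<nu> F"
  have fe: "finite_energy F" using F_mass F_energy by (simp add: finite_energy_def)
  have nz: "mass_density F \<noteq> 0" using F_pos by simp
  \<comment> \<open>The state is affine in \<open>\<theta>\<close>, so the path is the segment
    required by Taylor's formula.\<close>
  have path: "transitional_state \<nu> F \<theta> = (1, 0, 0) + \<theta> *\<^sub>R ?d" for \<theta>
    by (simp add: transitional_state_def state_deviation_def algebra_simps)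
  \<comment> \<open>The mixture inherits nonnegativity, positive mass and finite energy, so its
    tensor has positive determinant.\<close>
  have seg: "(1, 0, 0) + \<theta> *\<^sub>R ?d \<in> state_domain \<nu>" if \<theta>: "\<theta> \<in> {0..1}" for \<theta>
  proof -
    let ?F = "\<lambda>w. \<theta> * F w + (1 - \<theta>) * maxwellian w"
    have "AE w in lebesgue. 0 \<le> ?F w"
      using F_nonneg by eventually_elim (use \<theta> in \<open>simp add: maxwellian_def\<close>)
    moreover have "0 < mass_density ?F"
    proof (cases "\<theta> = 1")
      case False
      then show ?thesis
        unfolding mass_density_comb[OF fe finite_energy_maxwellian] maxwellian_moments
        using F_pos \<theta> by (intro add_nonneg_pos mult_nonneg_nonneg) auto
    qed (use F_pos in simp)
    ultimately show ?thesis
      unfolding path[symmetric] transitional_state_eq_state_of_mixture[OF fe F_pos \<theta>]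
      by (intro state_of_in_domain nu finite_energy_comb fe finite_energy_maxwellian)
  qed
  have C2: "Ck_on 2 (state_domain \<nu>) ?g" by (rule Ck_on_gaussian_of_state)
  note taylor = taylor_2_segment[OF open_state_domain C2 seg]
  have end1: "(1, 0, 0) + ?d = state_of \<nu> F"
    by (simp add: state_deviation_def state_of_def)
  have end0: "?g (1, 0, 0) = maxwellian v"
    unfolding gaussian_of_state_eq state_tensor_equilibrium by (simp add: gaussian_mat_1)
  have D: "partial_deriv ?g ?d (1, 0, 0) = P_nu \<nu> f v * sqrt (maxwellian v)"
    unfolding state_deviation_def partial_deriv_gaussian_of_state_equilibrium
      sym_matrix_G_coords[OF fe nz] P_nu_eq[OF F_f fe nz] ..
  show ?thesis
    using C2_on_imp_twice_differentiable_at[OF open_state_domain C2 seg] taylor(1)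
      taylor(2)[unfolded end1 gaussian_of_state_state_of[OF fe nz] end0 D]
    unfolding path by blast
qed

end
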